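(* Let $\{f_n(x)\}_{n\ge 0}$, $f_n(x)=\sum_{k=0}^{n}a(n,k)x^k$, be a P-recursive polynomial sequence such that every $f_n(x)$ has nonnegative coefficients $a(n,k)$ and only real roots. Suppose that $\{f_n(x)\}_{n\ge 0}$ is well-defined (in the sense given in the context), with associated positive integer $\rho$ and real exponents $r_1<r_2<r_3$ (belonging to $f_n(1)$, $f_n'(1)$, $f_n''(1)$ respectively). Let $$\mu_n=\frac{f_n'(1)}{f_n(1)},\qquad \sigma_n^2=\frac{f_n''(1)}{f_n(1)}+\mu_n-\mu_n^2 .$$ Suppose that the following two conditions hold. (1) The limits $a=\lim_{n\to+\infty}\frac{f_n'(1)}{f_n(1)\,n^{r_2-r_1}}$ and $b=\lim_{n\to+\infty}\frac{f_n''(1)}{f_n(1)\,n^{r_3-r_1}}$ both exist. (2) There exists an integer $m$ with $1/\rho\le m\le r_3-r_1$ such that, for the indices $0\le s\le m-1$, the coefficient of $n^s$ in (the asymptotic expansion of) $\sigma_n^2$ is zero, while the coefficient of $n^m$ in $\sigma_n^2$ is positive. Then the numbers $a(n,k)$ are asymptotically normal, by local and central limit theorems, with mean $\mu_n$ and variance $\sigma_n^2$.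
   Context: P-recursive polynomial sequence: $\{f_n(x)\}_{n\ge0}$ satisfies a recurrence $p_0(n,x)f_n(x)+p_1(n,x)f_{n+1}(x)+\cdots+p_d(n,x)f_{n+d}(x)=0$ for all $n\ge 1$, where the $p_i(n,x)$ are polynomials in $n$ and $x$, not all zero. Well-defined: a P-recursive polynomial sequence $\{f_n(x)\}_{n\ge0}$ is called well-defined if there are positive integers $\rho,M$, real numbers $\mu_1,\dots,\mu_\rho$ (constants, not to be confused with the means $\mu_n$), real numbers $r_1<r_2<r_3$, and, for $i=0,1,2$, constants $C_i'$ and real numbers $\beta_s^{(i)}$ ($0\le s\le M$) with $\beta_0^{(i)}>0$, such that as $n\to\infty$ $$f_n^{(i)}(1)=C_i'\,e^{Q(\rho,n)}\,n^{r_{i+1}}\Big(\sum_{s=0}^{M}\beta_s^{(i)}n^{-s/\rho}+o(n^{-M/\rho})\Big),\qquad i=0,1,2,$$ where $Q(\rho,n)=\sum_{j=1}^{\rho}\mu_j n^{j/\rho}$ (the same for all three $i$) and $f_n^{(i)}$ is the $i$-th derivative of $f_n$ with respect to $x$. Coefficients in $\sigma_n^2$: substituting these expansions in the definition of $\sigma_n^2$ gives an asymptotic expansion of $\sigma_n^2$ as a finite linear combination of real powers $n^{e}$, $e\ge 0$, plus a remainder $o(1)$ (with $M$ large enough for this precision). "The coefficient of $n^s$ in $\sigma_n^2$" is the coefficient in this expansion (zero if the power does not occur). It is understood that $f_n(1)>0$, so that the normalized probabilities below are defined. Asymptotic normality: let $p(n,k)=a(n,k)/\sum_{j=0}^n a(n,j)$,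 with $a(n,k)=0$ if $k<0$ or $k>n$. The numbers $a(n,k)$ are asymptotically normal with mean $\mu_n$ and variance $\sigma_n^2$ by a central limit theorem if $$\lim_{n\to\infty}\sup_{x\in\mathbb{R}}\Big|\sum_{k\le\mu_n+x\sigma_n}p(n,k)-\frac1{\sqrt{2\pi}}\int_{-\infty}^x e^{-t^2/2}\,dt\Big|=0,$$ and by a local limit theorem (on $\mathbb{R}$) if $$\lim_{n\to\infty}\sup_{x\in\mathbb{R}}\Big|\sigma_n\,p(n,\lfloor\mu_n+x\sigma_n\rfloor)-\frac1{\sqrt{2\pi}}e^{-x^2/2}\Big|=0.$$ *)

theory Defs
  imports
    "HOL-Probability.Probability"
    "HOL-Computational_Algebra.Polynomial"
    "HOL-Library.Landau_Symbols"
begin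

text \<open>
  A polynomial \<open>p(n, x)\<close> is a \<open>real poly poly\<close>: the outer variable is \<open>n\<close>, the coefficients are
  polynomials in \<open>x\<close>. The term \<open>poly p [:real n:]\<close> specialises \<open>n\<close> and is a polynomial in \<open>x\<close>, so
  the recurrence is an identity of polynomials in \<open>x\<close>.
\<close>

definition P_recursive :: "(nat \<Rightarrow> real poly) \<Rightarrow> bool" where
  "P_recursive f \<longleftrightarrow>
     (\<exists>(d::nat) (p :: nat \<Rightarrow> real poly poly).
        (\<exists>i\<le>d. p i \<noteq> 0) \<and>
        (\<forall>n\<ge>1. (\<Sum>i\<le>d. poly (p i) [:real n:] * f (n + i)) = 0))"

text \<open>
  The data \<open>\<rho>, M, q, r, C, \<beta>\<close> witness that \<open>f\<close> is well-defined. Here \<open>q j\<close> is the \<open>j\<close>-th coefficient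
  of \<open>Q(\<rho>, n)\<close> for \<open>1 \<le> j \<le> \<rho>\<close>, the exponents are \<open>r 1 < r 2 < r 3\<close>, and \<open>C i\<close>, \<open>\<beta> i s\<close> belong to the
  \<open>i\<close>-th derivative. Values of these functions at other indices play no role.
\<close>

definition well_defined_with ::
  "(nat \<Rightarrow> real poly) \<Rightarrow> nat \<Rightarrow> nat \<Rightarrow> (nat \<Rightarrow> real) \<Rightarrow> (nat \<Rightarrow> real) \<Rightarrow> (nat \<Rightarrow> real)
     \<Rightarrow> (nat \<Rightarrow> nat \<Rightarrow> real) \<Rightarrow> bool" where
  "well_defined_with f \<rho> M q r C \<beta> \<longleftrightarrow>
     P_recursive f \<and> 0 < \<rho> \<and> 0 < M \<and> r 1 < r 2 \<and> r 2 < r 3 \<and>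
     (\<forall>i\<in>{0, 1, 2}. 0 < \<beta> i 0 \<and>
        (\<exists>err :: nat \<Rightarrow> real.
           err \<in> o(\<lambda>n. real n powr - (real M / real \<rho>)) \<and>
           (\<forall>\<^sub>F n in sequentially.
              poly ((pderiv ^^ i) (f n)) 1 =
                C i * exp (\<Sum>j=1..\<rho>. q j * real n powr (real j / real \<rho>)) * real n powr r (i + 1)
                * ((\<Sum>s=0..M. \<beta> i s * real n powr - (real s / real \<rho>)) + err n))))"

definition pmean :: "(nat \<Rightarrow> real poly) \<Rightarrow> nat \<Rightarrow> real" where
  "pmean f n = poly (pderiv (f n)) 1 / poly (f n) 1"

definition pvar :: "(nat \<Rightarrow> real poly) \<Rightarrow> nat \<Rightarrow> real" where
  "pvar f n = poly (pderiv (pderiv (f n))) 1 / poly (f n) 1 + pmean f n - (pmean f n)\<^sup>2"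

text \<open>
  \<open>c e\<close> is the coefficient of \<open>n\<^sup>e\<close> in an expansion of \<open>v\<close> as a finite linear combination of real
  powers with exponents \<open>e \<ge> 0\<close>, up to \<open>o(1)\<close>; it is \<open>0\<close> if the power does not occur.
\<close>

definition power_expansion :: "(nat \<Rightarrow> real) \<Rightarrow> (real \<Rightarrow> real) \<Rightarrow> bool" where
  "power_expansion v c \<longleftrightarrow>
     finite {e. c e \<noteq> 0} \<and> (\<forall>e<0. c e = 0) \<and>
     (\<lambda>n. v n - (\<Sum>e | c e \<noteq> 0. c e * real n powr e)) \<in> o(\<lambda>_. 1)"

lemma power_expansion_unique:
  assumes "power_expansion v c" "power_expansion v c'"
  shows "c = c'"
proof (rule ccontr)
  assume "c \<noteq> c'"
  define S where "S = {e. c e \<noteq> 0} \<union> {e. c' e \<noteq> 0}"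
  define d where "d = (\<lambda>e. c e - c' e)"
  define D where "D = {e. d e \<noteq> 0}"
  define m where "m = Max D"
  have S: "finite S" using assms by (auto simp: S_def power_expansion_def)
  have DS: "D \<subseteq> S" by (auto simp: D_def d_def S_def)
  hence D: "finite D" using S finite_subset by blast
  have "D \<noteq> {}" using \<open>c \<noteq> c'\<close> by (auto simp: D_def d_def fun_eq_iff)
  hence mD: "m \<in> D" using D by (simp add: m_def)
  have m0: "m \<ge> 0"
    using mD assms by (force simp: D_def d_def power_expansion_def not_less[symmetric])
  have 1: "(\<Sum>e | c e \<noteq> 0. c e * real n powr e) = (\<Sum>e\<in>S. c e * real n powr e)" for n
    using S by (intro sum.mono_neutral_left) (auto simp: S_def)
  have 2: "(\<Sum>e | c' e \<noteq> 0. c' e * real n powr e) = (\<Sum>e\<in>S. c' e * real n powr e)" for n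
    using S by (intro sum.mono_neutral_left) (auto simp: S_def)
  have 3: "(\<Sum>e\<in>S. d e * real n powr e) = (\<Sum>e\<in>D. d e * real n powr e)" for n
    using S DS by (intro sum.mono_neutral_right) (auto simp: D_def)
  have "(\<lambda>n. (v n - (\<Sum>e | c' e \<noteq> 0. c' e * real n powr e))
           - (v n - (\<Sum>e | c e \<noteq> 0. c e * real n powr e))) \<in> o(\<lambda>_. 1)"
    by (rule sum_in_smallo(2)) (use assms in \<open>auto simp: power_expansion_def\<close>)
  also have "(\<lambda>n. (v n - (\<Sum>e | c' e \<noteq> 0. c' e * real n powr e))
           - (v n - (\<Sum>e | c e \<noteq> 0. c e * real n powr e))) = (\<lambda>n. \<Sum>e\<in>D. d e * real n powr e)"
    unfolding 1 2 3[symmetric] by (simp add: d_def sum_subtractf algebra_simps)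
  finally have lim0: "(\<lambda>n. \<Sum>e\<in>D. d e * real n powr e) \<longlonglongrightarrow> 0"
    by (auto dest: smalloD_tendsto)
  have "(\<lambda>n. (\<Sum>e\<in>D. d e * real n powr e) * real n powr (- m)) \<longlonglongrightarrow> 0"
  proof (rule tendsto_0_le[OF lim0, of _ 1])
    show "\<forall>\<^sub>F n in sequentially. norm ((\<Sum>e\<in>D. d e * real n powr e) * real n powr - m)
            \<le> norm (\<Sum>e\<in>D. d e * real n powr e) * 1"
      using eventually_ge_at_top[of 1]
    proof eventually_elim
      case (elim n)
      have "real n powr (- m) \<le> real n powr 0" using elim m0 by (intro powr_mono) auto
      thus ?case using elim by (simp add: abs_mult mult_left_le)
    qed
  qed
  moreover have "(\<lambda>n. \<Sum>e\<in>D. d e * real n powr (e - m)) \<longlonglongrightarrow> (\<Sum>e\<in>D. if e = m then d e else 0)"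
  proof (rule tendsto_sum)
    fix e assume e: "e \<in> D"
    show "(\<lambda>n. d e * real n powr (e - m)) \<longlonglongrightarrow> (if e = m then d e else 0)"
    proof (cases "e = m")
      case True
      have "\<forall>\<^sub>F n in sequentially. d e * real n powr (e - m) = d e"
        using eventually_gt_at_top[of 0] by eventually_elim (use True in auto)
      thus ?thesis using True by (simp add: tendsto_eventually)
    next
      case False
      hence "e - m < 0" using e D by (simp add: m_def order_neq_le_trans)
      hence "(\<lambda>n. real n powr (e - m)) \<longlonglongrightarrow> 0"
        by (intro tendsto_neg_powr filterlim_real_sequentially)
      from tendsto_mult_right_zero[OF this, of "d e"] show ?thesis using False by simp
    qed
  qed
  moreover have "(\<Sum>e\<in>D. d e * real n powr e) * real n powr (- m) = (\<Sum>e\<in>D. d e * real n powr (e - m))" for n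
    by (simp add: sum_distrib_right mult.assoc powr_add[symmetric])
  ultimately have "(\<Sum>e\<in>D. if e = m then d e else 0) = 0"
    by (simp add: LIMSEQ_unique)
  hence "d m = 0" using D mD by simp
  thus False using mD by (simp add: D_def)
qed

text \<open>Meaningful only for sequences that possess an expansion, which is then unique.\<close>

definition power_coeff :: "(nat \<Rightarrow> real) \<Rightarrow> real \<Rightarrow> real" where
  "power_coeff v = (THE c. power_expansion v c)"

lemma power_coeff_eq: "power_expansion v c \<Longrightarrow> power_coeff v = c"
  unfolding power_coeff_def by (blast intro: power_expansion_unique)

definition nprob :: "(nat \<Rightarrow> nat \<Rightarrow> real) \<Rightarrow> nat \<Rightarrow> int \<Rightarrow> real" where
  "nprob a n k =
     (if 0 \<le> k \<and> k \<le> int n then a n (nat k) / (\<Sum>j=0..n. a n j) else 0)"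

text \<open>
  The sum over all integers \<open>k \<le> \<mu> n + x \<sigma> n\<close> is restricted to the finitely many \<open>k\<close> in
  \<open>{0..int n}\<close>, outside of which \<open>nprob a n\<close> vanishes. Both suprema below are over sets bounded
  above, for every \<open>n\<close>.
\<close>

definition asymp_normal_central ::
  "(nat \<Rightarrow> nat \<Rightarrow> real) \<Rightarrow> (nat \<Rightarrow> real) \<Rightarrow> (nat \<Rightarrow> real) \<Rightarrow> bool" where
  "asymp_normal_central a \<mu> \<sigma>2 \<longleftrightarrow>
     (\<lambda>n. SUP x::real.
        \<bar>(\<Sum>k | k \<in> {0..int n} \<and> real_of_int k \<le> \<mu> n + x * sqrt (\<sigma>2 n). nprob a n k)
          - (LBINT t:{..x}. std_normal_density t)\<bar>) \<longlonglongrightarrow> 0"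

definition asymp_normal_local ::
  "(nat \<Rightarrow> nat \<Rightarrow> real) \<Rightarrow> (nat \<Rightarrow> real) \<Rightarrow> (nat \<Rightarrow> real) \<Rightarrow> bool" where
  "asymp_normal_local a \<mu> \<sigma>2 \<longleftrightarrow>
     (\<lambda>n. SUP x::real.
        \<bar>sqrt (\<sigma>2 n) * nprob a n \<lfloor>\<mu> n + x * sqrt (\<sigma>2 n)\<rfloor> - std_normal_density x\<bar>) \<longlonglongrightarrow> 0"

end

theory Submission
  imports Defs "HOL-Computational_Algebra.Fundamental_Theorem_Algebra"
begin

text \<open>
  A real-rooted polynomial with nonnegative coefficients, normalised by its value at \<open>1\<close>, factors
  into terms \<open>1 - p + p x\<close> with \<open>0 \<le> p \<le> 1\<close>; hence \<open>nprob a n\<close> is the law of a sum of independent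
  Bernoulli variables with mean \<open>pmean f n\<close> and variance \<open>pvar f n\<close>. The asymptotics of the three
  derivatives give the variance an expansion in powers of \<open>n\<close>; since a positive power occurs in it
  and the variance is nonnegative, the leading coefficient is positive, so the variance tends to
  infinity. The local limit theorem then follows by Fourier inversion: the characteristic functions
  of the normalised variables converge pointwise to \<open>exp (-u^2/2)\<close> and are dominated by
  \<open>exp (-u^2/16)\<close> on the range of integration. The local limit theorem says that the step densities
  of the normalised variables converge pointwise to the normal density, so Scheffe's argument gives
  convergence of the distribution functions, uniformly in \<open>x\<close>.
\<close>

section \<open>Power expansions\<close>

lemma power_expansion_add:
  assumes "power_expansion v c" "power_expansion v' c'"
  shows "power_expansion (\<lambda>n. v n + v' n) (\<lambda>e. c e + c' e)"
proof -
  let ?S = "{e. c e \<noteq> 0} \<union> {e. c' e \<noteq> 0}"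
  have S: "finite ?S" using assms by (auto simp: power_expansion_def)
  have 1: "(\<Sum>e | c e \<noteq> 0. c e * real n powr e) = (\<Sum>e\<in>?S. c e * real n powr e)" for n
    using S by (intro sum.mono_neutral_left) auto
  have 2: "(\<Sum>e | c' e \<noteq> 0. c' e * real n powr e) = (\<Sum>e\<in>?S. c' e * real n powr e)" for n
    using S by (intro sum.mono_neutral_left) auto
  have 3: "(\<Sum>e | c e + c' e \<noteq> 0. (c e + c' e) * real n powr e)
             = (\<Sum>e\<in>?S. (c e + c' e) * real n powr e)" for n
    using S by (intro sum.mono_neutral_left) auto
  have "(\<lambda>n. (v n - (\<Sum>e | c e \<noteq> 0. c e * real n powr e))
           + (v' n - (\<Sum>e | c' e \<noteq> 0. c' e * real n powr e))) \<in> o(\<lambda>_. 1)"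
    by (rule sum_in_smallo(1)) (use assms in \<open>auto simp: power_expansion_def\<close>)
  also have "(\<lambda>n. (v n - (\<Sum>e | c e \<noteq> 0. c e * real n powr e))
           + (v' n - (\<Sum>e | c' e \<noteq> 0. c' e * real n powr e)))
      = (\<lambda>n. v n + v' n - (\<Sum>e | c e + c' e \<noteq> 0. (c e + c' e) * real n powr e))"
    unfolding 1 2 3 by (simp add: sum.distrib algebra_simps)
  finally have 4: "(\<lambda>n. v n + v' n - (\<Sum>e | c e + c' e \<noteq> 0. (c e + c' e) * real n powr e)) \<in> o(\<lambda>_. 1)" .
  have "finite {e. c e + c' e \<noteq> 0}"
    by (rule finite_subset[OF _ S]) auto
  thus ?thesis using 4 assms by (auto simp: power_expansion_def)
qed

lemma power_expansion_smallo:
  assumes "v \<in> o(\<lambda>_. 1)"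
  shows "power_expansion v (\<lambda>_. 0)"
  using assms by (simp add: power_expansion_def)

lemma power_expansion_powr:
  assumes "e \<ge> 0"
  shows "power_expansion (\<lambda>n. k * real n powr e) (\<lambda>x. if x = e then k else 0)"
proof -
  have "{x. (if x = e then k else 0) \<noteq> 0} = (if k = 0 then {} else {e})" by auto
  thus ?thesis using assms by (auto simp: power_expansion_def)
qed

text \<open>A negative exponent is absorbed into the o(1) remainder, and the expansion is then the
  zero one.\<close>

lemma ex_power_expansion_powr: "\<exists>c. power_expansion (\<lambda>n. k * real n powr e) c"
proof (cases "e \<ge> 0")
  case True
  thus ?thesis using power_expansion_powr by blast
next
  case False
  hence "(\<lambda>n. real n powr e) \<longlonglongrightarrow> 0"
    by (intro tendsto_neg_powr filterlim_real_sequentially) auto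
  hence "(\<lambda>n. k * real n powr e) \<in> o(\<lambda>_. 1)"
    by (intro smalloI_tendsto) (auto intro: tendsto_mult_right_zero)
  thus ?thesis using power_expansion_smallo by blast
qed

lemma ex_power_expansion_sum:
  assumes "finite I" "\<And>i. i \<in> I \<Longrightarrow> \<exists>c. power_expansion (v i) c"
  shows "\<exists>c. power_expansion (\<lambda>n. \<Sum>i\<in>I. v i n) c"
  using assms
proof (induction I rule: finite_induct)
  case empty
  thus ?case using power_expansion_smallo[of "\<lambda>_. 0"] by auto
next
  case (insert i I)
  then obtain c c' where "power_expansion (v i) c" "power_expansion (\<lambda>n. \<Sum>i\<in>I. v i n) c'"
    by force
  from power_expansion_add[OF this] show ?case using insert.hyps by auto
qed

lemma power_expansion_cong:
  assumes "\<forall>\<^sub>F n in sequentially. v n = v' n" "power_expansion v c"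
  shows "power_expansion v' c"
proof -
  have "(\<lambda>n. v n - (\<Sum>e | c e \<noteq> 0. c e * real n powr e)) \<in> o(\<lambda>_. 1) \<longleftrightarrow>
        (\<lambda>n. v' n - (\<Sum>e | c e \<noteq> 0. c e * real n powr e)) \<in> o(\<lambda>_. 1)"
    using assms(1) by (intro landau_o.small.in_cong) (auto elim: eventually_mono)
  thus ?thesis using assms(2) by (simp add: power_expansion_def)
qed

text \<open>Let \<open>m\<close> be the largest exponent that occurs. It is at least
  \<open>e\<close>, hence positive, and dividing by n^m shows that
  \<open>v n * real n powr (- m)\<close> tends to \<open>c m\<close>. Eventual nonnegativity of
  \<open>v\<close> forces this nonzero limit to be positive, so \<open>v\<close> grows like n^m,
  even if \<open>e\<close> itself is not the leading exponent.\<close>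

lemma power_expansion_at_top:
  assumes v: "power_expansion v c" and nonneg: "\<forall>\<^sub>F n in sequentially. 0 \<le> v n"
    and e: "e > 0" "c e \<noteq> 0"
  shows "filterlim v at_top sequentially"
proof -
  define D where "D = {e. c e \<noteq> 0}"
  define m where "m = Max D"
  have D: "finite D" using v by (auto simp: D_def power_expansion_def)
  have eD: "e \<in> D" using e by (simp add: D_def)
  have m: "m > 0" using Max_ge[OF D eD] e by (simp add: m_def)
  have cm: "c m \<noteq> 0" using Max_in[OF D] eD by (auto simp: m_def D_def)
  hence mD: "m \<in> D" by (simp add: D_def)
  have neg: "(\<lambda>n. real n powr b) \<longlonglongrightarrow> 0" if "b < 0" for b
    using that by (intro tendsto_neg_powr filterlim_real_sequentially)
  have "(\<lambda>n. v n - (\<Sum>e\<in>D. c e * real n powr e)) \<longlonglongrightarrow> 0"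
    using v by (auto simp: power_expansion_def D_def dest: smalloD_tendsto)
  hence "(\<lambda>n. (v n - (\<Sum>e\<in>D. c e * real n powr e)) * real n powr (- m)) \<longlonglongrightarrow> 0 * 0"
    using m by (intro tendsto_mult neg) auto
  moreover have "(\<lambda>n. \<Sum>e\<in>D. c e * real n powr (e - m)) \<longlonglongrightarrow> (\<Sum>e\<in>D. if e = m then c e else 0)"
  proof (rule tendsto_sum)
    fix e assume e: "e \<in> D"
    show "(\<lambda>n. c e * real n powr (e - m)) \<longlonglongrightarrow> (if e = m then c e else 0)"
    proof (cases "e = m")
      case True
      have "\<forall>\<^sub>F n in sequentially. c e * real n powr (e - m) = c e"
        using eventually_gt_at_top[of 0] by eventually_elim (use True in auto)
      thus ?thesis using True by (simp add: tendsto_eventually)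
    next
      case False
      hence "e - m < 0" using Max_ge[OF D e] by (simp add: m_def)
      from tendsto_mult_right_zero[OF neg[OF this], of "c e"] show ?thesis using False by simp
    qed
  qed
  ultimately have "(\<lambda>n. (v n - (\<Sum>e\<in>D. c e * real n powr e)) * real n powr (- m)
      + (\<Sum>e\<in>D. c e * real n powr (e - m))) \<longlonglongrightarrow> 0 * 0 + (\<Sum>e\<in>D. if e = m then c e else 0)"
    by (intro tendsto_add)
  moreover have "(v n - (\<Sum>e\<in>D. c e * real n powr e)) * real n powr (- m)
      + (\<Sum>e\<in>D. c e * real n powr (e - m)) = v n * real n powr (- m)" for n
    by (simp add: left_diff_distrib sum_distrib_right mult.assoc powr_add[symmetric])
  ultimately have lim: "(\<lambda>n. v n * real n powr (- m)) \<longlonglongrightarrow> c m"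
    using D mD by simp
  have "c m \<ge> 0"
    by (rule tendsto_lowerbound[OF lim]) (use nonneg in \<open>auto elim: eventually_mono\<close>)
  hence "c m > 0" using cm by simp
  hence "filterlim (\<lambda>n. (v n * real n powr (- m)) * real n powr m) at_top sequentially"
    using m by (intro filterlim_tendsto_pos_mult_at_top[OF lim] real_powr_at_top[THEN filterlim_compose] 
       filterlim_real_sequentially) auto
  moreover have "\<forall>\<^sub>F n in sequentially. (v n * real n powr (- m)) * real n powr m = v n"
    using eventually_gt_at_top[of 0]
    by eventually_elim (simp add: mult.assoc powr_add[symmetric])
  ultimately show ?thesis by (simp cong: filterlim_cong)
qed

section \<open>Expansions in powers of a null sequence\<close>

text \<open>With \<open>t n\<close> equal to n^(-1/\<rho>) this is the kind of expansion that
  \<open>well_defined_with\<close> provides, of precision n^(-M/\<rho>). The degree of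
  \<open>P\<close> is left free, so that products and inverses need no truncation.\<close>

definition poly_approx :: "(nat \<Rightarrow> real) \<Rightarrow> nat \<Rightarrow> (nat \<Rightarrow> real) \<Rightarrow> bool" where
  "poly_approx t M v \<longleftrightarrow> (\<exists>P. (\<lambda>n. v n - poly P (t n)) \<in> o(\<lambda>n. t n ^ M))"

lemma poly_tendsto_0:
  fixes t :: "nat \<Rightarrow> real"
  assumes "t \<longlonglongrightarrow> 0" shows "(\<lambda>n. poly P (t n)) \<longlonglongrightarrow> poly P 0"
  using assms by (intro tendsto_intros)

lemma poly_approx_tendsto:
  fixes t :: "nat \<Rightarrow> real"
  assumes t: "t \<longlonglongrightarrow> 0" and v: "(\<lambda>n. v n - poly P (t n)) \<in> o(\<lambda>n. t n ^ M)"
  shows "v \<longlonglongrightarrow> poly P 0"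
proof -
  have "(\<lambda>n. t n ^ M) \<in> O(\<lambda>_. 1)"
    using tendsto_power[OF t, of M] by (intro bigoI_tendsto[where c = "0 ^ M"]) auto
  from landau_o.small_big_trans[OF v this] have "(\<lambda>n. v n - poly P (t n)) \<longlonglongrightarrow> 0"
    by (auto dest: smalloD_tendsto)
  from tendsto_add[OF this poly_tendsto_0[OF t, of P]] show ?thesis by simp
qed

text \<open>Write v w - P Q = (v - P) w + (w - Q) P; the factors \<open>w\<close> and P(t) are
  bounded because they converge.\<close>

lemma poly_approx_mult:
  fixes t :: "nat \<Rightarrow> real"
  assumes t: "t \<longlonglongrightarrow> 0" and "poly_approx t M v" "poly_approx t M w"
  shows "poly_approx t M (\<lambda>n. v n * w n)"
proof -
  obtain P Q where P: "(\<lambda>n. v n - poly P (t n)) \<in> o(\<lambda>n. t n ^ M)"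
    and Q: "(\<lambda>n. w n - poly Q (t n)) \<in> o(\<lambda>n. t n ^ M)"
    using assms by (auto simp: poly_approx_def)
  have "w \<in> O(\<lambda>_. 1)"
    using poly_approx_tendsto[OF t Q] by (intro bigoI_tendsto[where c = "poly Q 0"]) auto
  from landau_o.small_big_mult[OF P this]
  have 1: "(\<lambda>n. (v n - poly P (t n)) * w n) \<in> o(\<lambda>n. t n ^ M)" by simp
  have "(\<lambda>n. poly P (t n)) \<in> O(\<lambda>_. 1)"
    using poly_tendsto_0[OF t] by (intro bigoI_tendsto[where c = "poly P 0"]) auto
  from landau_o.small_big_mult[OF Q this]
  have 2: "(\<lambda>n. (w n - poly Q (t n)) * poly P (t n)) \<in> o(\<lambda>n. t n ^ M)" by simp
  have "(\<lambda>n. v n * w n - poly (P * Q) (t n)) \<in> o(\<lambda>n. t n ^ M)"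
    using sum_in_smallo(1)[OF 1 2] by (simp add: algebra_simps)
  thus ?thesis unfolding poly_approx_def by (rule exI)
qed

text \<open>With \<open>P = P(0) (1 - X U)\<close>, the inverse of \<open>P\<close> modulo \<open>X^(M+1)\<close> is a truncated geometric series.\<close>

lemma poly_inverse_mod_power:
  fixes P :: "real poly"
  assumes "poly P 0 \<noteq> 0"
  obtains B R where "P * B = 1 - monom 1 (Suc M) * R"
proof -
  obtain c P' where P: "P = pCons c P'" by (cases P)
  have c: "c \<noteq> 0" using assms by (simp add: P)
  define V where "V = monom 1 1 * smult (- 1 / c) P'"
  have PV: "P = smult c (1 - V)"
    using c by (simp add: V_def P monom_altdef smult_diff_right one_pCons)
  have "P * smult (1 / c) (\<Sum>i<Suc M. V ^ i) = (1 - V) * (\<Sum>i<Suc M. V ^ i)"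
    using c by (simp add: PV)
  also have "\<dots> = 1 - V ^ Suc M" by (rule one_diff_power_eq[symmetric])
  also have "V ^ Suc M = monom 1 (Suc M) * (smult (- 1 / c) P') ^ Suc M"
    unfolding V_def power_mult_distrib by (simp add: monom_power del: power_Suc)
  finally show ?thesis by (rule that)
qed

text \<open>Let \<open>B\<close> be the inverse of \<open>P\<close> modulo X^(M+1). Then 1/v - B(t)
  = (1 - v B(t)) / v, and the numerator equals t^(M+1) R(t) - (v - P(t)) B(t). Both terms are
  o(t^M), and 1/v is bounded because \<open>v\<close> tends to P(0), which is nonzero.\<close>

lemma poly_approx_inverse:
  fixes t :: "nat \<Rightarrow> real"
  assumes t: "t \<longlonglongrightarrow> 0" and P: "(\<lambda>n. v n - poly P (t n)) \<in> o(\<lambda>n. t n ^ M)" and P0: "poly P 0 \<noteq> 0"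
  shows "poly_approx t M (\<lambda>n. inverse (v n))"
proof -
  obtain B R where B: "P * B = 1 - monom 1 (Suc M) * R" by (rule poly_inverse_mod_power[OF P0])
  have lim: "v \<longlonglongrightarrow> poly P 0" by (rule poly_approx_tendsto[OF t P])
  hence nz: "\<forall>\<^sub>F n in sequentially. v n \<noteq> 0" using P0 by (rule tendsto_imp_eventually_ne)
  have inv: "(\<lambda>n. inverse (v n)) \<in> O(\<lambda>_. 1)"
    using tendsto_inverse[OF lim P0] by (intro bigoI_tendsto[where c = "inverse (poly P 0)"]) auto
  have "(\<lambda>n. poly B (t n)) \<in> O(\<lambda>_. 1)"
    using poly_tendsto_0[OF t] by (intro bigoI_tendsto[where c = "poly B 0"]) auto
  from landau_o.small_big_mult[OF P this]
  have 1: "(\<lambda>n. (v n - poly P (t n)) * poly B (t n)) \<in> o(\<lambda>n. t n ^ M)" by simp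
  have "(\<lambda>n. t n * poly R (t n)) \<longlonglongrightarrow> 0"
    using tendsto_mult[OF t poly_tendsto_0[OF t, of R]] by simp
  hence "(\<lambda>n. t n * poly R (t n)) \<in> o(\<lambda>_. 1)" by (intro smalloI_tendsto) auto
  from landau_o.big_small_mult[OF landau_o.big_refl[of "\<lambda>n. t n ^ M"] this]
  have 2: "(\<lambda>n. t n ^ M * (t n * poly R (t n))) \<in> o(\<lambda>n. t n ^ M)" by simp
  from landau_o.small_big_mult[OF sum_in_smallo(2)[OF 2 1] inv]
  have "(\<lambda>n. (t n ^ M * (t n * poly R (t n)) - (v n - poly P (t n)) * poly B (t n)) * inverse (v n))
     \<in> o(\<lambda>n. t n ^ M)" by simp
  also have "?this \<longleftrightarrow> (\<lambda>n. inverse (v n) - poly B (t n)) \<in> o(\<lambda>n. t n ^ M)"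
  proof (rule landau_o.small.in_cong)
    show "\<forall>\<^sub>F n in sequentially. (t n ^ M * (t n * poly R (t n)) - (v n - poly P (t n)) * poly B (t n)) * inverse (v n)
       = inverse (v n) - poly B (t n)"
      using nz
    proof eventually_elim
      case (elim n)
      have "poly P (t n) * poly B (t n) = 1 - t n ^ Suc M * poly R (t n)"
        using arg_cong[OF B, of "\<lambda>p. poly p (t n)"] by (simp add: poly_monom)
      hence "t n ^ M * (t n * poly R (t n)) - (v n - poly P (t n)) * poly B (t n) = 1 - v n * poly B (t n)"
        by (simp add: algebra_simps)
      thus ?case using elim by (simp add: field_simps)
    qed
  qed
  finally show ?thesis by (auto simp: poly_approx_def)
qed

text \<open>The polynomial part contributes finitely many real powers of n. The bound on
  \<open>e\<close> says that n^e t^M stays bounded, so that the error o(t^M), multiplied by n^e, is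
  still o(1).\<close>

lemma poly_approx_ex_power_expansion:
  assumes \<rho>: "0 < \<rho>" and v: "poly_approx (\<lambda>n. real n powr - (1 / real \<rho>)) M v"
    and e: "e \<le> real M / real \<rho>"
  shows "\<exists>c. power_expansion (\<lambda>n. k * real n powr e * v n) c"
proof -
  let ?t = "\<lambda>n. real n powr - (1 / real \<rho>)"
  obtain P where P: "(\<lambda>n. v n - poly P (?t n)) \<in> o(\<lambda>n. ?t n ^ M)"
    using v by (auto simp: poly_approx_def)
  have pw: "real n powr e * ?t n ^ i = real n powr (e - real i / real \<rho>)" if "n > 0" for n i
    using that by (simp add: powr_power powr_add[symmetric])
  have "\<forall>\<^sub>F n in sequentially. norm (real n powr e * ?t n ^ M) \<le> 1 * norm (1 :: real)"
    using eventually_ge_at_top[of 1]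
  proof eventually_elim
    case (elim n)
    have "real n powr (e - real M / real \<rho>) \<le> real n powr 0"
      using elim e by (intro powr_mono) auto
    thus ?case using elim pw[of n M] by simp
  qed
  hence 1: "(\<lambda>n. real n powr e * ?t n ^ M) \<in> O(\<lambda>_. 1)" by (rule bigoI)
  have "(\<lambda>n. (k * real n powr e) * (v n - poly P (?t n))) \<in> o(\<lambda>n. (real n powr e) * (?t n ^ M))"
    by (rule landau_o.big_small_mult[OF _ P]) auto
  from landau_o.small_big_trans[OF this 1]
  have 2: "power_expansion (\<lambda>n. (k * real n powr e) * (v n - poly P (?t n))) (\<lambda>_. 0)"
    by (rule power_expansion_smallo)
  have "\<exists>c. power_expansion (\<lambda>n. \<Sum>i\<le>degree P. (k * coeff P i) * real n powr (e - real i / real \<rho>)) c"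
    by (intro ex_power_expansion_sum ex_power_expansion_powr) auto
  then obtain c where "power_expansion (\<lambda>n. \<Sum>i\<le>degree P. (k * coeff P i) * real n powr (e - real i / real \<rho>)) c" ..
  note 3 = power_expansion_add[OF this 2]
  have "\<forall>\<^sub>F n in sequentially. (\<Sum>i\<le>degree P. (k * coeff P i) * real n powr (e - real i / real \<rho>))
     + (k * real n powr e) * (v n - poly P (?t n)) = k * real n powr e * v n"
    using eventually_gt_at_top[of 0]
  proof eventually_elim
    case (elim n)
    have "(\<Sum>i\<le>degree P. (k * coeff P i) * real n powr (e - real i / real \<rho>)) = k * real n powr e * poly P (?t n)"
      unfolding poly_altdef sum_distrib_left
      by (intro sum.cong refl) (simp add: pw[OF elim, symmetric] mult_ac)
    thus ?case by (simp add: algebra_simps)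
  qed
  from power_expansion_cong[OF this 3] show ?thesis by blast
qed

text \<open>Existence of the expansion is what makes \<open>power_coeff (pvar f)\<close> meaningful.
  The exponential factor cancels in the quotients of derivatives, leaving powers of n times
  functions with a \<open>poly_approx\<close> expansion. The highest powers are n^(r3 - r1) and n^(2
  (r2 - r1)), whence the two conditions on \<open>M\<close>.\<close>

lemma ex_power_expansion_pvar:
  assumes wd: "well_defined_with f \<rho> M q r C \<beta>" and pos: "\<And>n. 0 < poly (f n) 1"
    and M: "r 3 - r 1 \<le> real M / real \<rho>" "2 * (r 2 - r 1) \<le> real M / real \<rho>"
  shows "\<exists>c. power_expansion (pvar f) c"
proof -
  define t where "t = (\<lambda>n. real n powr - (1 / real \<rho>))"
  define E where "E = (\<lambda>n. exp (\<Sum>j=1..\<rho>. q j * real n powr (real j / real \<rho>)))"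
  have \<rho>: "0 < \<rho>" and r: "r 1 < r 2" "r 2 < r 3" using wd by (auto simp: well_defined_with_def)
  have t0: "t \<longlonglongrightarrow> 0" unfolding t_def using \<rho>
    by (intro tendsto_neg_powr filterlim_real_sequentially) auto
  \<comment> \<open>This fails for n = 0 and s = 0, since \<open>0 powr x\<close> is 0 while a
    zeroth power is 1; the comparisons below therefore hold only eventually.\<close>
  have tp: "t n ^ s = real n powr - (real s / real \<rho>)" if "n > 0" for n s
    using that by (simp add: t_def powr_power)
  \<comment> \<open>The factor \<open>E n\<close> is common to the three derivatives. What remains
    after splitting it off is a polynomial in \<open>t n\<close> up to o(t^M), and its constant term
    \<open>\<beta> i 0\<close> is positive; this permits the inversion in the case i = 0.\<close>
  have *: "\<exists>v. (\<exists>P. (\<lambda>n. v n - poly P (t n)) \<in> o(\<lambda>n. t n ^ M) \<and> poly P 0 \<noteq> 0) \<and>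
     (\<forall>\<^sub>F n in sequentially. poly ((pderiv ^^ i) (f n)) 1 = C i * E n * real n powr r (i + 1) * v n)"
    if i: "i \<in> {0,1,2}" for i
  proof -
    obtain err where err: "err \<in> o(\<lambda>n. real n powr - (real M / real \<rho>))"
      and b: "0 < \<beta> i 0" and eq: "\<forall>\<^sub>F n in sequentially.
              poly ((pderiv ^^ i) (f n)) 1 = C i * E n * real n powr r (i + 1)
                * ((\<Sum>s=0..M. \<beta> i s * real n powr - (real s / real \<rho>)) + err n)"
      using wd i unfolding well_defined_with_def E_def by blast
    define P where "P = (\<Sum>s=0..M. monom (\<beta> i s) s)"
    have "o(\<lambda>n. real n powr - (real M / real \<rho>)) = o(\<lambda>n. t n ^ M)"
    proof (rule landau_o.small.cong)
      show "\<forall>\<^sub>F n in sequentially. real n powr - (real M / real \<rho>) = t n ^ M"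
        using eventually_gt_at_top[of 0] by eventually_elim (simp add: tp)
    qed
    hence "(\<lambda>n. (poly P (t n) + err n) - poly P (t n)) \<in> o(\<lambda>n. t n ^ M)" using err by simp
    moreover have "poly P 0 = \<beta> i 0"
      by (simp add: P_def poly_sum poly_monom power_0_left sum.If_cases if_distrib cong: if_cong)
    moreover have "\<forall>\<^sub>F n in sequentially. poly ((pderiv ^^ i) (f n)) 1
        = C i * E n * real n powr r (i + 1) * (poly P (t n) + err n)"
      using eq eventually_gt_at_top[of 0]
      by eventually_elim (simp add: P_def poly_sum poly_monom tp)
    ultimately show ?thesis using b
      by (intro exI[of _ "\<lambda>n. poly P (t n) + err n"] conjI exI[of _ P]) auto
  qed
  obtain v0 P0 where v0: "(\<lambda>n. v0 n - poly P0 (t n)) \<in> o(\<lambda>n. t n ^ M)" "poly P0 0 \<noteq> 0"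
    "\<forall>\<^sub>F n in sequentially. poly (f n) 1 = C 0 * E n * real n powr r 1 * v0 n"
    using *[of 0] by auto
  obtain v1 P1 where v1: "(\<lambda>n. v1 n - poly P1 (t n)) \<in> o(\<lambda>n. t n ^ M)"
    "\<forall>\<^sub>F n in sequentially. poly (pderiv (f n)) 1 = C 1 * E n * real n powr r 2 * v1 n"
    using *[of 1] by (auto simp: numeral_2_eq_2)
  obtain v2 P2 where v2: "(\<lambda>n. v2 n - poly P2 (t n)) \<in> o(\<lambda>n. t n ^ M)"
    "\<forall>\<^sub>F n in sequentially. poly (pderiv (pderiv (f n))) 1 = C 2 * E n * real n powr r 3 * v2 n"
    using *[of 2] by (auto simp: numeral_2_eq_2 numeral_3_eq_3)
  have inv: "poly_approx t M (\<lambda>n. inverse (v0 n))" by (rule poly_approx_inverse[OF t0 v0(1,2)])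
  have w1: "poly_approx t M (\<lambda>n. v1 n * inverse (v0 n))"
    by (rule poly_approx_mult[OF t0 _ inv]) (use v1 in \<open>auto simp: poly_approx_def\<close>)
  have w2: "poly_approx t M (\<lambda>n. v2 n * inverse (v0 n))"
    by (rule poly_approx_mult[OF t0 _ inv]) (use v2 in \<open>auto simp: poly_approx_def\<close>)
  note ex = poly_approx_ex_power_expansion[OF \<rho>, folded t_def]
  have le: "r 2 - r 1 \<le> real M / real \<rho>" using M r by simp
  obtain c1 where c1: "power_expansion (\<lambda>n. (C 2 / C 0) * real n powr (r 3 - r 1) * (v2 n * inverse (v0 n))) c1"
    using ex[OF w2 M(1)] by blast
  obtain c2 where c2: "power_expansion (\<lambda>n. (C 1 / C 0) * real n powr (r 2 - r 1) * (v1 n * inverse (v0 n))) c2"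
    using ex[OF w1 le] by blast
  obtain c3 where c3: "power_expansion (\<lambda>n. (- ((C 1 / C 0)\<^sup>2)) * real n powr (2 * (r 2 - r 1))
       * ((v1 n * inverse (v0 n)) * (v1 n * inverse (v0 n)))) c3"
    using ex[OF poly_approx_mult[OF t0 w1 w1] M(2)] by blast
  note pe = power_expansion_add[OF power_expansion_add[OF c1 c2] c3]
  have "\<forall>\<^sub>F n in sequentially.
      (C 2 / C 0) * real n powr (r 3 - r 1) * (v2 n * inverse (v0 n))
      + (C 1 / C 0) * real n powr (r 2 - r 1) * (v1 n * inverse (v0 n))
      + (- ((C 1 / C 0)\<^sup>2)) * real n powr (2 * (r 2 - r 1))
       * ((v1 n * inverse (v0 n)) * (v1 n * inverse (v0 n))) = pvar f n"
    using v0(3) v1(2) v2(2) eventually_gt_at_top[of 0]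
  proof eventually_elim
    case (elim n)
    \<comment> \<open>These are the factors of \<open>poly (f n) 1\<close>, which is positive, so
      none of them vanishes.\<close>
    have nz: "C 0 \<noteq> 0" "v0 n \<noteq> 0" "real n powr r 1 \<noteq> 0" "E n \<noteq> 0" using pos[of n] elim by auto
    have m: "pmean f n = (C 1 / C 0) * real n powr (r 2 - r 1) * (v1 n * inverse (v0 n))"
      using nz unfolding pmean_def elim by (simp add: powr_diff field_simps)
    have "poly (pderiv (pderiv (f n))) 1 / poly (f n) 1
        = (C 2 / C 0) * real n powr (r 3 - r 1) * (v2 n * inverse (v0 n))"
      using nz unfolding elim by (simp add: powr_diff field_simps)
    moreover have "(real n powr (r 2 - r 1))\<^sup>2 = real n powr (2 * (r 2 - r 1))"
      using elim by (simp add: powr_power mult.commute)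
    ultimately show ?case
      by (simp add: pvar_def m power_mult_distrib power2_eq_square mult_ac)
  qed
  from power_expansion_cong[OF this pe] show ?thesis by blast
qed

section \<open>Real-rooted polynomials\<close>

lemma poly_map_of_real:
  fixes F :: "real poly"
  shows "poly (map_poly of_real F) (of_real x :: complex) = of_real (poly F x)"
  by (simp add: poly_altdef degree_map_poly coeff_map_poly)

text \<open>Since \<open>F\<close> is positive on the positive half-line, its real roots x satisfy x
  <= 0. Hence w - x = (1 - x) (1 - p + p w) with p = 1 / (1 - x), which lies between 0 and 1, and
  the factors 1 - x together with the leading coefficient multiply to F(1). The identity is stated
  for complex w because it is later evaluated on the unit circle.\<close>

lemma real_rooted_nonneg_factorization:
  fixes F :: "real poly"
  assumes nonneg: "\<And>k. 0 \<le> coeff F k" and pos: "0 < poly F 1"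
    and real_roots: "\<And>z::complex. poly (map_poly of_real F) z = 0 \<Longrightarrow> z \<in> \<real>"
  shows "\<exists>(N::nat) p. (\<forall>i<N. 0 \<le> p i \<and> p i \<le> 1) \<and> (\<forall>w::complex. poly (map_poly of_real F) w =
      of_real (poly F 1) * (\<Prod>i<N. 1 - of_real (p i) + of_real (p i) * w))"
proof -
  define H where "H = (map_poly of_real F :: complex poly)"
  have F_pos: "poly F x > 0" if "x > 0" for x
  proof -
    have "0 \<le> poly F x"
      using that nonneg by (auto simp: poly_altdef intro!: sum_nonneg)
    moreover have "poly F x \<noteq> 0"
    proof
      assume "poly F x = 0"
      hence "\<forall>i\<in>{..degree F}. coeff F i * x ^ i = 0"
        unfolding poly_altdef using that nonneg by (subst (asm) sum_nonneg_eq_0_iff) auto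
      hence "\<forall>i\<in>{..degree F}. coeff F i = 0" using that by auto
      hence "poly F 1 = 0" by (simp add: poly_altdef)
      thus False using pos by simp
    qed
    ultimately show ?thesis by simp
  qed
  have H_real: "poly H (of_real x) = of_real (poly F x)" for x
    unfolding H_def by (rule poly_map_of_real)
  have "H \<noteq> 0" using H_real[of 1] pos by auto
  from alg_closed_imp_factorization[OF this]
  obtain A where A: "H = smult (lead_coeff H) (\<Prod>x\<in>#A. [:-x, 1:])" by blast
  \<comment> \<open>Listing the multiset indexes the roots, with multiplicity, by natural
    numbers.\<close>
  obtain xs where xs: "mset xs = A" using ex_mset by blast
  have "(\<Prod>x\<in>#A. [:-x, 1:]) = (\<Prod>i<length xs. [:- (xs ! i), 1:])"
    unfolding xs[symmetric] mset_map[symmetric] prod_mset_prod_list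
    by (simp add: prod.list_conv_set_nth atLeast0LessThan)
  hence H: "poly H w = lead_coeff H * (\<Prod>i<length xs. w - xs ! i)" for w
    by (subst A) (simp add: poly_prod)
  have root: "xs ! i = of_real (Re (xs ! i)) \<and> Re (xs ! i) \<le> 0" if i: "i < length xs" for i
  proof -
    have "(\<Prod>j<length xs. xs ! i - xs ! j) = 0" using i by (intro prod_zero) auto
    hence z: "poly H (xs ! i) = 0" by (simp add: H)
    hence "xs ! i \<in> \<real>" using real_roots by (simp add: H_def)
    hence eq: "xs ! i = of_real (Re (xs ! i))" by (simp add: complex_is_Real_iff complex_eq_iff)
    hence "poly F (Re (xs ! i)) = 0" using z H_real by (metis of_real_eq_0_iff)
    thus ?thesis using eq F_pos[of "Re (xs ! i)"] by force
  qed
  define p where "p = (\<lambda>i. 1 / (1 - Re (xs ! i)))"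
  have H1: "of_real (poly F 1) = lead_coeff H * (\<Prod>i<length xs. 1 - xs ! i)"
    using H_real[of 1] H[of 1] by simp
  show ?thesis
  proof (intro exI[of _ "length xs"] exI[of _ p] conjI allI impI)
    fix i assume "i < length xs"
    thus "0 \<le> p i" "p i \<le> 1"
      using root[of i, THEN conjunct2] by (auto simp: p_def)
  next
    fix w :: complex
    have "w - xs ! i = (1 - xs ! i) * (1 - of_real (p i) + of_real (p i) * w)" if "i < length xs" for i
    proof -
      have "p i * (1 - Re (xs ! i)) = 1" using root[OF that, THEN conjunct2] by (simp add: p_def)
      hence "complex_of_real (p i) * (1 - of_real (Re (xs ! i))) = 1"
        by (metis of_real_1 of_real_diff of_real_mult)
      hence "of_real (p i) * (1 - xs ! i) = 1" using root[OF that] by metis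
      moreover have "(1 - xs ! i) * (1 - of_real (p i) + of_real (p i) * w)
        = (1 - xs ! i) - of_real (p i) * (1 - xs ! i) + of_real (p i) * (1 - xs ! i) * w"
        by (simp add: algebra_simps)
      ultimately show ?thesis by simp
    qed
    hence "(\<Prod>i<length xs. w - xs ! i) = (\<Prod>i<length xs. 1 - xs ! i) * (\<Prod>i<length xs. 1 - of_real (p i) + of_real (p i) * w)"
      by (simp add: prod.distrib[symmetric])
    thus "poly (map_poly of_real F) w = of_real (poly F 1) * (\<Prod>i<length xs. 1 - of_real (p i) + of_real (p i) * w)"
      unfolding H1 H_def[symmetric] H[of w] by simp
  qed
qed

text \<open>Induction with the product rule: each new factor is linear with value 1 and slope
  \<open>p N\<close> at 1. As \<open>G N\<close> is the generating function of a sum X of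
  independent Bernoulli variables, its derivatives at 1 are the factorial moments E X and E X(X -
  1).\<close>

lemma bernoulli_prod_derivs_at_1:
  fixes p :: "nat \<Rightarrow> real"
  defines "G \<equiv> \<lambda>N. \<Prod>i<N. [:1 - p i, p i:]"
  shows "poly (G N) 1 = 1" "poly (pderiv (G N)) 1 = (\<Sum>i<N. p i)"
    "poly (pderiv (pderiv (G N))) 1 = (\<Sum>i<N. p i)\<^sup>2 - (\<Sum>i<N. (p i)\<^sup>2)"
proof -
  have 1: "poly (G N) 1 = 1" for N
    by (simp add: G_def poly_prod)
  have step: "G (Suc N) = G N * [:1 - p N, p N:]" for N by (simp add: G_def mult.commute)
  have 2: "poly (pderiv (G N)) 1 = (\<Sum>i<N. p i)" for N
  proof (induction N)
    case (Suc N)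
    have "poly (pderiv (G (Suc N))) 1 = poly (G N) 1 * p N + poly (pderiv (G N)) 1"
      unfolding step pderiv_mult poly_add poly_mult by (simp add: pderiv_pCons)
    thus ?case unfolding 1 Suc by simp
  qed (simp add: G_def)
  show "poly (G N) 1 = 1" "poly (pderiv (G N)) 1 = (\<Sum>i<N. p i)" by (fact 1 2)+
  show "poly (pderiv (pderiv (G N))) 1 = (\<Sum>i<N. p i)\<^sup>2 - (\<Sum>i<N. (p i)\<^sup>2)"
  proof (induction N)
    case (Suc N)
    have "poly (pderiv (pderiv (G (Suc N)))) 1 = 2 * poly (pderiv (G N)) 1 * p N + poly (pderiv (pderiv (G N))) 1"
      unfolding step pderiv_mult pderiv_add poly_add poly_mult by (simp add: pderiv_pCons)
    thus ?case unfolding 2 Suc by (simp add: power2_eq_square algebra_simps)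
  qed (simp add: G_def)
qed

text \<open>The complex factorization, restricted to real points, gives an identity of real
  polynomials, which can be differentiated at 1. The squares of the mean then cancel in
  \<open>pvar\<close>.\<close>

lemma pmean_pvar_bernoulli_prod:
  fixes N :: nat
  assumes pos: "0 < poly (f n) 1"
    and fac: "\<And>w::complex. poly (map_poly of_real (f n)) w =
      of_real (poly (f n) 1) * (\<Prod>i<N. 1 - of_real (p i) + of_real (p i) * w)"
  shows "pmean f n = (\<Sum>i<N. p i)" "pvar f n = (\<Sum>i<N. p i * (1 - p i))"
proof -
  define G where "G = (\<Prod>i<N. [:1 - p i, p i:])"
  have "poly (f n) x = poly (smult (poly (f n) 1) G) x" for x
  proof -
    have "complex_of_real (poly (f n) x) = poly (map_poly of_real (f n)) (of_real x)"
      by (simp only: poly_map_of_real)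
    also have "\<dots> = of_real (poly (smult (poly (f n) 1) G) x)"
      unfolding fac by (simp add: G_def poly_prod mult.commute)
    finally show ?thesis by (simp only: of_real_eq_iff)
  qed
  hence "poly (f n) = poly (smult (poly (f n) 1) G)" by (rule ext)
  hence f: "f n = smult (poly (f n) 1) G" by (simp only: poly_eq_poly_eq_iff)
  have d1: "poly (pderiv (f n)) 1 = poly (f n) 1 * (\<Sum>i<N. p i)"
    by (subst f) (simp add: pderiv_smult G_def bernoulli_prod_derivs_at_1)
  have d2: "poly (pderiv (pderiv (f n))) 1 = poly (f n) 1 * ((\<Sum>i<N. p i)\<^sup>2 - (\<Sum>i<N. (p i)\<^sup>2))"
    by (subst f) (simp add: pderiv_smult G_def bernoulli_prod_derivs_at_1)
  show m: "pmean f n = (\<Sum>i<N. p i)"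
    using pos by (simp add: pmean_def d1)
  have "poly (pderiv (pderiv (f n))) 1 / poly (f n) 1 = (\<Sum>i<N. p i)\<^sup>2 - (\<Sum>i<N. (p i)\<^sup>2)"
    using pos by (simp add: d2)
  thus "pvar f n = (\<Sum>i<N. p i * (1 - p i))"
    by (simp add: pvar_def m algebra_simps sum_subtractf power2_eq_square)
qed

section \<open>Characteristic functions\<close>

text \<open>The characteristic function of B - p for a Bernoulli variable B with parameter
  \<open>p\<close>. The shift is kept as a separate factor, so that in a product over i the
  remaining factors form the generating function at \<open>cis s\<close>.\<close>

definition centered_bernoulli_cf :: "real \<Rightarrow> real \<Rightarrow> complex" where
  "centered_bernoulli_cf p s = cis (- s * p) * (1 - of_real p + of_real p * cis s)"

text \<open>The expectation form: B - p takes the value -p with probability 1 - p and the value 1 -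
  p with probability p.\<close>

lemma centered_bernoulli_cf_altdef:
  "centered_bernoulli_cf p s = (1 - of_real p) * cis (- s * p) + of_real p * cis (s * (1 - p))"
proof -
  have "cis (s * (1 - p)) = cis (- s * p) * cis s" by (simp add: cis_mult algebra_simps)
  thus ?thesis by (simp add: centered_bernoulli_cf_def algebra_simps)
qed

lemma cmod_cis_taylor: "cmod (cis x - (1 + \<i> * of_real x - of_real x ^ 2 / 2)) \<le> \<bar>x\<bar> ^ 3 / 6"
proof -
  have "(\<Sum>k\<le>2. (\<i> * of_real x) ^ k / fact k) = 1 + \<i> * of_real x - of_real x ^ 2 / 2"
    by (simp add: numeral_2_eq_2 power_mult_distrib)
  thus ?thesis using iexp_approx1[of x 2] by (simp add: cis_conv_exp numeral_3_eq_3 numeral_2_eq_2)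
qed

text \<open>Centering kills the linear terms, and the quadratic ones add up to the variance p(1 -
  p). The error is governed by the third absolute moment p(1 - p)(p^2 + (1 - p)^2), which is at most
  the variance; being proportional to the variance, the errors can be summed over all
  factors.\<close>

lemma centered_bernoulli_cf_taylor:
  assumes p: "0 \<le> p" "p \<le> 1"
  shows "cmod (centered_bernoulli_cf p s - of_real (1 - s\<^sup>2 * (p * (1 - p)) / 2)) \<le> \<bar>s\<bar> ^ 3 / 6 * (p * (1 - p))"
proof -
  define e where "e = (\<lambda>x. cis x - (1 + \<i> * of_real x - of_real x ^ 2 / 2))"
  have e: "cmod (e x) \<le> \<bar>x\<bar> ^ 3 / 6" for x unfolding e_def by (rule cmod_cis_taylor)
  have "centered_bernoulli_cf p s - of_real (1 - s\<^sup>2 * (p * (1 - p)) / 2)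
      = of_real (1 - p) * e (- s * p) + of_real p * e (s * (1 - p))"
    unfolding centered_bernoulli_cf_altdef e_def by (simp add: field_simps power2_eq_square)
  also have "cmod \<dots> \<le> (1 - p) * cmod (e (- s * p)) + p * cmod (e (s * (1 - p)))"
    using p by (intro norm_triangle_le add_mono) (simp_all add: norm_mult del: of_real_diff)
  also have "\<dots> \<le> (1 - p) * (\<bar>- s * p\<bar> ^ 3 / 6) + p * (\<bar>s * (1 - p)\<bar> ^ 3 / 6)"
    using p by (intro add_mono mult_left_mono e) auto
  also have "\<dots> = \<bar>s\<bar> ^ 3 / 6 * (p * (1 - p)) * (p\<^sup>2 + (1 - p)\<^sup>2)"
    using p by (simp add: abs_mult power_mult_distrib) (simp add: power2_eq_square power3_eq_cube field_simps)
  also have "\<dots> \<le> \<bar>s\<bar> ^ 3 / 6 * (p * (1 - p)) * 1"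
  proof (rule mult_left_mono)
    have "p\<^sup>2 + (1 - p)\<^sup>2 = 1 - 2 * (p * (1 - p))" by (simp add: power2_eq_square algebra_simps)
    thus "p\<^sup>2 + (1 - p)\<^sup>2 \<le> 1" using p by simp
  qed (use p in auto)
  finally show ?thesis by simp
qed

text \<open>Taylor's formula gives cos s <= 1 - s^2/2 + s^4/24. Since pi <= 16/5, s^4 is at most
  256/25 s^2, and 1/2 - 256/600 = 11/150 exceeds 1/16. This 1/16 is the constant of the Gaussian
  majorant below.\<close>

lemma one_minus_cos_ge:
  fixes s :: real
  assumes "\<bar>s\<bar> \<le> pi"
  shows "s\<^sup>2 / 16 \<le> 1 - cos s"
proof -
  obtain t where t: "cos s = (\<Sum>m<4. cos_coeff m * s ^ m) + (cos (t + 1/2 * real 4 * pi) / fact 4) * s ^ 4"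
    using Maclaurin_cos_expansion[of s 4] by blast
  have "{..<4::nat} = {0, 1, 2, 3}" by auto
  hence "(\<Sum>m<4. cos_coeff m * s ^ m) = 1 - s\<^sup>2 / 2"
    by (simp add: cos_coeff_def)
  moreover have "cos (t + 1/2 * real 4 * pi) / fact 4 * s ^ 4 \<le> 1 / 24 * s ^ 4"
    by (intro mult_right_mono) (auto simp: fact_numeral)
  ultimately have c: "cos s \<le> 1 - s\<^sup>2 / 2 + s ^ 4 / 24" using t by linarith
  have "pi \<le> 16 / 5" using pi_approx by simp
  with assms have "\<bar>s\<bar> \<le> 16 / 5" by linarith
  hence "\<bar>s\<bar>\<^sup>2 \<le> (16 / 5)\<^sup>2" by (intro power_mono) auto
  hence "s\<^sup>2 * s\<^sup>2 \<le> 256 / 25 * s\<^sup>2" by (intro mult_right_mono) (auto simp: power2_eq_square)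
  hence "s ^ 4 \<le> 256 / 25 * s\<^sup>2" by (simp add: power4_eq_xxxx power2_eq_square mult.assoc)
  thus ?thesis using c zero_le_power2[of s] by linarith
qed

lemma cmod_centered_bernoulli_cf_squared: "(cmod (centered_bernoulli_cf p s))\<^sup>2 = 1 - 2 * (p * (1 - p)) * (1 - cos s)"
proof -
  have "(cmod (centered_bernoulli_cf p s))\<^sup>2 = (cmod (1 - of_real p + of_real p * cis s))\<^sup>2"
    by (simp add: centered_bernoulli_cf_def norm_mult)
  also have "\<dots> = (1 - p + p * cos s)\<^sup>2 + p\<^sup>2 * (sin s)\<^sup>2"
    by (simp add: cmod_power2 power_mult_distrib)
  also have "\<dots> = 1 - 2 * (p * (1 - p)) * (1 - cos s)"
    unfolding sin_squared_eq by (simp add: power2_eq_square algebra_simps)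
  finally show ?thesis .
qed

lemma cmod_centered_bernoulli_cf_le_1:
  assumes p: "0 \<le> p" "p \<le> 1"
  shows "cmod (centered_bernoulli_cf p s) \<le> 1"
proof -
  have "0 \<le> p * (1 - p) * (1 - cos s)" using p by simp
  hence "(cmod (centered_bernoulli_cf p s))\<^sup>2 \<le> 1\<^sup>2"
    unfolding cmod_centered_bernoulli_cf_squared by simp
  thus ?thesis by (rule power2_le_imp_le) auto
qed

text \<open>With v = p(1 - p), the squared modulus is at most 1 - 2 v s^2/16, and 1 + x <= exp x.
  The range of \<open>s\<close> keeps away from the next zero of 1 - cos s, at 2 pi.\<close>

lemma cmod_centered_bernoulli_cf_le_exp:
  assumes p: "0 \<le> p" "p \<le> 1" and s: "\<bar>s\<bar> \<le> pi"
  shows "cmod (centered_bernoulli_cf p s) \<le> exp (- (p * (1 - p) * s\<^sup>2 / 16))"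
proof -
  have v: "0 \<le> p * (1 - p)" using p by simp
  have "(cmod (centered_bernoulli_cf p s))\<^sup>2 \<le> 1 + (- 2 * (p * (1 - p)) * (s\<^sup>2 / 16))"
    using mult_left_mono[OF one_minus_cos_ge[OF s] v] unfolding cmod_centered_bernoulli_cf_squared by simp
  also have "\<dots> \<le> exp (- 2 * (p * (1 - p)) * (s\<^sup>2 / 16))" by (rule exp_ge_add_one_self)
  also have "\<dots> = (exp (- (p * (1 - p) * s\<^sup>2 / 16)))\<^sup>2" by (simp add: power2_eq_square mult_exp_exp)
  finally show ?thesis by (rule power2_le_imp_le) auto
qed

text \<open>The exponential lies between 1 - y and 1 / (1 + y), and the latter is at most 1 - y +
  y^2.\<close>

lemma exp_minus_taylor:
  fixes y :: real
  assumes "0 \<le> y"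
  shows "\<bar>exp (- y) - (1 - y)\<bar> \<le> y\<^sup>2"
proof -
  have "1 - y \<le> exp (- y)" using exp_ge_add_one_self[of "- y"] by simp
  moreover have "exp (- y) \<le> 1 / (1 + y)"
    using exp_ge_add_one_self[of y] assms by (simp add: exp_minus field_simps)
  moreover have "1 / (1 + y) \<le> 1 - y + y\<^sup>2"
    using assms by (simp add: field_simps power2_eq_square)
  ultimately show ?thesis by linarith
qed

text \<open>The exponents of the single factors add up to the total variance, which the scaling by
  \<open>\<sigma>\<close> cancels. The resulting bound depends on \<open>u\<close> alone and serves
  for dominated convergence.\<close>

lemma centered_bernoulli_cf_prod_tail:
  fixes N :: nat
  assumes p: "\<And>i. i < N \<Longrightarrow> 0 \<le> p i \<and> p i \<le> 1"
    and \<sigma>: "\<sigma> > 0" "\<sigma>\<^sup>2 = (\<Sum>i<N. p i * (1 - p i))" and u: "\<bar>u\<bar> \<le> pi * \<sigma>"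
  shows "cmod (\<Prod>i<N. centered_bernoulli_cf (p i) (u / \<sigma>)) \<le> exp (- u\<^sup>2 / 16)"
proof -
  have "\<bar>u / \<sigma>\<bar> \<le> pi" using u \<sigma> by (simp add: field_simps)
  hence "cmod (\<Prod>i<N. centered_bernoulli_cf (p i) (u / \<sigma>)) \<le> (\<Prod>i<N. exp (- (p i * (1 - p i) * (u / \<sigma>)\<^sup>2 / 16)))"
    unfolding prod_norm[symmetric] using p by (intro prod_mono) (auto intro!: cmod_centered_bernoulli_cf_le_exp)
  also have "\<dots> = exp (\<Sum>i<N. - (p i * (1 - p i) * (u / \<sigma>)\<^sup>2 / 16))"
    by (rule exp_sum[symmetric]) simp
  also have "(\<Sum>i<N. - (p i * (1 - p i) * (u / \<sigma>)\<^sup>2 / 16)) = - (\<sigma>\<^sup>2 * (u / \<sigma>)\<^sup>2 / 16)"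
    unfolding \<sigma>(2) by (simp only: sum_negf sum_divide_distrib sum_distrib_right)
  also have "\<sigma>\<^sup>2 * (u / \<sigma>)\<^sup>2 = u\<^sup>2" using \<sigma>(1) by (simp add: power_divide)
  finally show ?thesis by simp
qed

text \<open>Replacement of factors: exp(-u^2/2) is a product with one Gaussian factor for each
  variance p_i (1 - p_i). All factors have modulus at most 1, so the products differ by at most the
  sum of the differences of factors. Each difference is at most |s|^3 + s^4 times the variance of
  that factor, where s = u/\<sigma>.\<close>

lemma centered_bernoulli_cf_prod_approx:
  fixes N :: nat
  assumes p: "\<And>i. i < N \<Longrightarrow> 0 \<le> p i \<and> p i \<le> 1"
    and \<sigma>: "\<sigma> > 0" "\<sigma>\<^sup>2 = (\<Sum>i<N. p i * (1 - p i))"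
  shows "cmod ((\<Prod>i<N. centered_bernoulli_cf (p i) (u / \<sigma>)) - of_real (exp (- u\<^sup>2 / 2)))
           \<le> \<bar>u\<bar> ^ 3 / \<sigma> + u ^ 4 / \<sigma>\<^sup>2"
proof -
  define s where "s = u / \<sigma>"
  define v where "v = (\<lambda>i. p i * (1 - p i))"
  have v: "0 \<le> v i" "v i \<le> 1" if "i < N" for i
  proof -
    show "0 \<le> v i" using p[OF that] by (simp add: v_def)
    have "p i * (1 - p i) \<le> 1 * 1" using p[OF that] by (intro mult_mono) auto
    thus "v i \<le> 1" by (simp add: v_def)
  qed
  have \<sigma>v: "(\<Sum>i<N. v i) = \<sigma>\<^sup>2" using \<sigma> by (simp add: v_def)
  have "(\<Prod>i<N. exp (- (s\<^sup>2 * v i / 2))) = exp (\<Sum>i<N. - (s\<^sup>2 * v i / 2))"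
    by (rule exp_sum[symmetric]) simp
  also have "(\<Sum>i<N. - (s\<^sup>2 * v i / 2)) = - (s\<^sup>2 * \<sigma>\<^sup>2 / 2)"
    unfolding \<sigma>v[symmetric] by (simp add: sum_negf sum_divide_distrib sum_distrib_left)
  also have "s\<^sup>2 * \<sigma>\<^sup>2 = u\<^sup>2" using \<sigma>(1) by (simp add: s_def power_divide)
  finally have "of_real (exp (- u\<^sup>2 / 2)) = (\<Prod>i<N. complex_of_real (exp (- (s\<^sup>2 * v i / 2))))"
    by (simp add: of_real_prod[symmetric])
  hence "cmod ((\<Prod>i<N. centered_bernoulli_cf (p i) s) - of_real (exp (- u\<^sup>2 / 2))) \<le>
      (\<Sum>i<N. cmod (centered_bernoulli_cf (p i) s - of_real (exp (- (s\<^sup>2 * v i / 2)))))"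
    using p v by (auto intro!: norm_prod_diff cmod_centered_bernoulli_cf_le_1)
  also have "\<dots> \<le> (\<Sum>i<N. (\<bar>s\<bar> ^ 3 + s ^ 4) * v i)"
  proof (rule sum_mono)
    fix i assume "i \<in> {..<N}"
    hence i: "i < N" by simp
    have 1: "cmod (centered_bernoulli_cf (p i) s - of_real (1 - s\<^sup>2 * v i / 2)) \<le> \<bar>s\<bar> ^ 3 / 6 * v i"
      unfolding v_def using p[OF i] by (intro centered_bernoulli_cf_taylor) auto
    have "\<bar>exp (- (s\<^sup>2 * v i / 2)) - (1 - s\<^sup>2 * v i / 2)\<bar> \<le> (s\<^sup>2 * v i / 2)\<^sup>2"
      using v[OF i] by (intro exp_minus_taylor) auto
    hence 2: "cmod (complex_of_real (1 - s\<^sup>2 * v i / 2) - of_real (exp (- (s\<^sup>2 * v i / 2)))) \<le> (s\<^sup>2 * v i / 2)\<^sup>2"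
      unfolding of_real_diff[symmetric] norm_of_real by (simp add: abs_minus_commute)
    have "(s\<^sup>2 * v i / 2)\<^sup>2 = s ^ 4 / 4 * (v i * v i)"
      by (simp add: power2_eq_square power4_eq_xxxx)
    also have "\<dots> \<le> s ^ 4 * (v i * 1)"
      using v[OF i] by (intro mult_mono) auto
    finally have 3: "(s\<^sup>2 * v i / 2)\<^sup>2 \<le> s ^ 4 * v i" by simp
    have "\<bar>s\<bar> ^ 3 / 6 * v i \<le> \<bar>s\<bar> ^ 3 * v i" using v[OF i] by (intro mult_right_mono) auto
    thus "cmod (centered_bernoulli_cf (p i) s - of_real (exp (- (s\<^sup>2 * v i / 2)))) \<le> (\<bar>s\<bar> ^ 3 + s ^ 4) * v i"
      using norm_triangle_le[OF order_trans[OF add_mono[OF 1 2] order_refl]] 3 by (simp add: algebra_simps)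
  qed
  also have "\<dots> = (\<bar>s\<bar> ^ 3 + s ^ 4) * \<sigma>\<^sup>2" by (simp add: sum_distrib_left[symmetric] \<sigma>v)
  also have "\<dots> = \<bar>u\<bar> ^ 3 / \<sigma> + u ^ 4 / \<sigma>\<^sup>2"
    using \<sigma>(1) by (simp add: s_def field_simps abs_divide power2_eq_square power3_eq_cube power4_eq_xxxx)
  finally show ?thesis by (simp add: s_def)
qed

section \<open>Fourier inversion on the lattice and for the Gaussian\<close>

text \<open>Orthogonality of characters over one period, rescaled by \<open>\<sigma>\<close>. For
  \<open>d\<close> nonzero the antiderivative takes equal values at both ends, because sin vanishes
  at integer multiples of pi and cos is even.\<close>

lemma integral_cis_lattice:
  fixes d :: int
  assumes \<sigma>: "\<sigma> > 0"
  shows "has_bochner_integral lborel (\<lambda>u. indicator {- (pi * \<sigma>)..pi * \<sigma>} u *\<^sub>R cis (u * real_of_int d / \<sigma>))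
           (if d = 0 then of_real (2 * pi * \<sigma>) else 0)"
proof (cases "d = 0")
  case True
  have "has_bochner_integral lborel (\<lambda>u. indicator {- (pi * \<sigma>)..pi * \<sigma>} u *\<^sub>R (1::complex))
     (of_real (pi * \<sigma>) - of_real (- (pi * \<sigma>)))"
    using \<sigma> by (intro has_bochner_integral_FTC_Icc)
       (auto intro!: derivative_eq_intros has_vector_derivative_of_real)
  thus ?thesis using True by (simp add: algebra_simps)
next
  case False
  define c where "c = real_of_int d / \<sigma>"
  have c: "c \<noteq> 0" using False \<sigma> by (simp add: c_def)
  define F where "F = (\<lambda>u. Complex (sin (u * c) / c) (- cos (u * c) / c))"
  have "has_bochner_integral lborel (\<lambda>u. indicator {- (pi * \<sigma>)..pi * \<sigma>} u *\<^sub>R cis (u * c))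
     (F (pi * \<sigma>) - F (- (pi * \<sigma>)))"
  proof (rule has_bochner_integral_FTC_Icc)
    show "(F has_vector_derivative cis (x * c)) (at x within {- (pi * \<sigma>)..pi * \<sigma>})" for x
      unfolding F_def has_vector_derivative_complex_iff using c
      by (auto intro!: derivative_eq_intros simp: field_simps)
  qed (use \<sigma> in \<open>auto intro!: continuous_intros\<close>)
  moreover have "pi * \<sigma> * c = pi * real_of_int d" using \<sigma> by (simp add: c_def)
  hence "sin (pi * \<sigma> * c) = 0" by (auto simp: sin_zero_iff_int2)
  hence "F (pi * \<sigma>) - F (- (pi * \<sigma>)) = 0" by (simp add: F_def complex_eq_iff)
  ultimately show ?thesis using False by (simp add: c_def)
qed

text \<open>The last factor removes the centering, so that the j-th term becomes the character of j
  - k and only j = k survives the integration. For k outside the support no term survives, and P k =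
  0.\<close>

lemma lattice_inversion:
  assumes \<sigma>: "\<sigma> > 0" and supp: "\<And>k. k \<notin> {0..int n} \<Longrightarrow> P k = 0"
  shows "has_bochner_integral lborel (\<lambda>u. indicator {- (pi * \<sigma>)..pi * \<sigma>} u *\<^sub>R
      ((\<Sum>j\<in>{0..int n}. of_real (P j) * cis (u / \<sigma> * (real_of_int j - \<mu>))) * cis (- u * ((real_of_int k - \<mu>) / \<sigma>))))
      (of_real (2 * pi * (\<sigma> * P k)))"
proof -
  have "has_bochner_integral lborel (\<lambda>u. \<Sum>j\<in>{0..int n}. of_real (P j) *
      (indicator {- (pi * \<sigma>)..pi * \<sigma>} u *\<^sub>R cis (u * real_of_int (j - k) / \<sigma>)))
     (\<Sum>j\<in>{0..int n}. of_real (P j) * (if j - k = 0 then of_real (2 * pi * \<sigma>) else 0))"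
    by (intro has_bochner_integral_sum has_bochner_integral_mult_right integral_cis_lattice[OF \<sigma>])
  also have "(\<Sum>j\<in>{0..int n}. of_real (P j) * (if j - k = 0 then complex_of_real (2 * pi * \<sigma>) else 0))
     = of_real (2 * pi * (\<sigma> * P k))"
    using supp[of k] by (cases "k \<in> {0..int n}") (auto simp: if_distrib cong: if_cong)
  also have "(\<lambda>u. \<Sum>j\<in>{0..int n}. of_real (P j) *
      (indicator {- (pi * \<sigma>)..pi * \<sigma>} u *\<^sub>R cis (u * real_of_int (j - k) / \<sigma>))) =
      (\<lambda>u. indicator {- (pi * \<sigma>)..pi * \<sigma>} u *\<^sub>R
      ((\<Sum>j\<in>{0..int n}. of_real (P j) * cis (u / \<sigma> * (real_of_int j - \<mu>))) * cis (- u * ((real_of_int k - \<mu>) / \<sigma>))))"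
  proof
    fix u
    have "of_real (P j) * cis (u / \<sigma> * (real_of_int j - \<mu>)) * cis (- u * ((real_of_int k - \<mu>) / \<sigma>))
       = of_real (P j) * cis (u * real_of_int (j - k) / \<sigma>)" for j
    proof -
      have "u / \<sigma> * (real_of_int j - \<mu>) + - u * ((real_of_int k - \<mu>) / \<sigma>) = u * real_of_int (j - k) / \<sigma>"
        using \<sigma> by (simp add: field_simps)
      thus ?thesis by (simp only: mult.assoc cis_mult)
    qed
    note eq = this
    show "(\<Sum>j\<in>{0..int n}. of_real (P j) *
      (indicator {- (pi * \<sigma>)..pi * \<sigma>} u *\<^sub>R cis (u * real_of_int (j - k) / \<sigma>))) =
      indicator {- (pi * \<sigma>)..pi * \<sigma>} u *\<^sub>R
      ((\<Sum>j\<in>{0..int n}. of_real (P j) * cis (u / \<sigma> * (real_of_int j - \<mu>))) * cis (- u * ((real_of_int k - \<mu>) / \<sigma>)))"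
      unfolding sum_distrib_right scaleR_sum_right mult_scaleR_right by (simp only: eq)
  qed
  finally show ?thesis .
qed

text \<open>The characteristic function of the standard normal law, taken at -x, is again a
  Gaussian; multiplication by sqrt(2 pi) removes the normalising constant of the density under the
  integral.\<close>

lemma gaussian_inversion:
  "has_bochner_integral lborel (\<lambda>u. of_real (exp (- u\<^sup>2 / 2)) * cis (- u * x)) (of_real (2 * pi * std_normal_density x))"
proof -
  have int: "integrable lborel (\<lambda>u. std_normal_density u *\<^sub>R cis (- x * u))"
    by (rule Bochner_Integration.integrable_bound[OF integrable_normal_density[where \<mu> = 0 and \<sigma> = 1]])
       (auto simp: cis_conv_exp)
  have "complex_of_real (exp (- x\<^sup>2 / 2)) = char std_normal_distribution (- x)"
    by (simp add: char_std_normal_distribution)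
  also have "\<dots> = (CLINT u|lborel. std_normal_density u *\<^sub>R cis (- x * u))"
    unfolding char_def by (subst integral_density) (auto simp: cis_conv_exp)
  finally have "has_bochner_integral lborel (\<lambda>u. std_normal_density u *\<^sub>R cis (- x * u)) (of_real (exp (- x\<^sup>2 / 2)))"
    using int by (simp add: has_bochner_integral_iff)
  from has_bochner_integral_mult_right[OF this, of "of_real (sqrt (2 * pi))"]
  have "has_bochner_integral lborel (\<lambda>u. of_real (sqrt (2 * pi)) * (std_normal_density u *\<^sub>R cis (- x * u)))
     (of_real (sqrt (2 * pi)) * of_real (exp (- x\<^sup>2 / 2)))" by simp
  also have "(\<lambda>u. of_real (sqrt (2 * pi)) * (std_normal_density u *\<^sub>R cis (- x * u)))
     = (\<lambda>u. of_real (exp (- u\<^sup>2 / 2)) * cis (- u * x))"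
    by (auto simp: fun_eq_iff std_normal_density_def scaleR_conv_of_real mult_ac)
  also have "complex_of_real (sqrt (2 * pi)) * of_real (exp (- x\<^sup>2 / 2)) = of_real (2 * pi * std_normal_density x)"
  proof -
    have "2 * pi = sqrt (2 * pi) * sqrt (2 * pi)" by simp
    hence "sqrt (2 * pi) * exp (- x\<^sup>2 / 2) = 2 * pi * std_normal_density x"
      unfolding std_normal_density_def by (simp add: field_simps)
    thus ?thesis by (simp only: of_real_mult[symmetric])
  qed
  finally show ?thesis .
qed

lemma continuous_on_centered_bernoulli_cf [continuous_intros]:
  "continuous_on A f \<Longrightarrow> continuous_on A (\<lambda>x. centered_bernoulli_cf p (f x))"
  unfolding centered_bernoulli_cf_def by (intro continuous_intros)

lemma integrable_exp_minus_square:
  fixes c :: real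
  assumes "c > 0"
  shows "integrable lborel (\<lambda>u. exp (- u\<^sup>2 / c))"
proof -
  have "integrable lborel (\<lambda>u. sqrt (pi * c) * normal_density 0 (sqrt (c / 2)) u)"
    using assms by (intro integrable_mult_right integrable_normal_density) auto
  also have "(\<lambda>u. sqrt (pi * c) * normal_density 0 (sqrt (c / 2)) u) = (\<lambda>u. exp (- u\<^sup>2 / c))"
    using assms by (auto simp: normal_density_def fun_eq_iff)
  finally show ?thesis .
qed

section \<open>The local limit theorem\<close>

text \<open>Subtract the two inversion formulas at the point that corresponds to \<open>k\<close>.
  Both integrands carry the same phase, of modulus 1, so the L1 distance of the characteristic
  functions bounds the error uniformly in \<open>k\<close>.\<close>

lemma local_limit_error_bound:
  assumes \<sigma>: "\<sigma> > 0" and supp: "\<And>k. k \<notin> {0..int n} \<Longrightarrow> P k = 0"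
    and \<psi>: "\<And>s. (\<Sum>j\<in>{0..int n}. of_real (P j) * cis (s * (real_of_int j - \<mu>))) = \<psi> s"
  shows "2 * pi * \<bar>\<sigma> * P k - std_normal_density ((real_of_int k - \<mu>) / \<sigma>)\<bar>
    \<le> (LBINT u. cmod (indicator {- (pi * \<sigma>)..pi * \<sigma>} u *\<^sub>R \<psi> (u / \<sigma>) - of_real (exp (- u\<^sup>2 / 2))))"
proof -
  let ?x = "(real_of_int k - \<mu>) / \<sigma>"
  have "has_bochner_integral lborel (\<lambda>u. indicator {- (pi * \<sigma>)..pi * \<sigma>} u *\<^sub>R (\<psi> (u / \<sigma>) * cis (- u * ?x))
      - of_real (exp (- u\<^sup>2 / 2)) * cis (- u * ?x))
      (of_real (2 * pi * (\<sigma> * P k)) - of_real (2 * pi * std_normal_density ?x))"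
    using lattice_inversion[where P = P and n = n and \<mu> = \<mu> and k = k, OF \<sigma> supp] unfolding \<psi>
    by (rule has_bochner_integral_diff[OF _ gaussian_inversion])
  also have "(\<lambda>u. indicator {- (pi * \<sigma>)..pi * \<sigma>} u *\<^sub>R (\<psi> (u / \<sigma>) * cis (- u * ?x))
      - of_real (exp (- u\<^sup>2 / 2)) * cis (- u * ?x))
     = (\<lambda>u. (indicator {- (pi * \<sigma>)..pi * \<sigma>} u *\<^sub>R \<psi> (u / \<sigma>) - of_real (exp (- u\<^sup>2 / 2))) * cis (- u * ?x))"
    by (simp add: left_diff_distrib)
  also have "complex_of_real (2 * pi * (\<sigma> * P k)) - of_real (2 * pi * std_normal_density ?x)
     = of_real (2 * pi * (\<sigma> * P k - std_normal_density ?x))"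
    by (simp add: algebra_simps)
  finally have *: "has_bochner_integral lborel
     (\<lambda>u. (indicator {- (pi * \<sigma>)..pi * \<sigma>} u *\<^sub>R \<psi> (u / \<sigma>) - of_real (exp (- u\<^sup>2 / 2))) * cis (- u * ?x))
     (of_real (2 * pi * (\<sigma> * P k - std_normal_density ?x)))" .
  have "2 * pi * \<bar>\<sigma> * P k - std_normal_density ?x\<bar> = cmod (of_real (2 * pi * (\<sigma> * P k - std_normal_density ?x)))"
    unfolding norm_of_real by (simp add: abs_mult)
  also have "\<dots> \<le> (LBINT u. cmod ((indicator {- (pi * \<sigma>)..pi * \<sigma>} u *\<^sub>R \<psi> (u / \<sigma>) - of_real (exp (- u\<^sup>2 / 2))) * cis (- u * ?x)))"
    unfolding has_bochner_integral_integral_eq[OF *, symmetric] by (rule integral_norm_bound)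
  also have "\<dots> = (LBINT u. cmod (indicator {- (pi * \<sigma>)..pi * \<sigma>} u *\<^sub>R \<psi> (u / \<sigma>) - of_real (exp (- u\<^sup>2 / 2))))"
    by (simp add: norm_mult)
  finally show ?thesis .
qed

text \<open>Dominated convergence: the product approximation gives the pointwise limit, and the two
  Gaussian bounds give an integrable majorant.\<close>

lemma centered_bernoulli_cf_prod_L1_limit:
  fixes N :: "nat \<Rightarrow> nat" and p :: "nat \<Rightarrow> nat \<Rightarrow> real"
  assumes p: "\<And>n i. i < N n \<Longrightarrow> 0 \<le> p n i \<and> p n i \<le> 1"
    and var: "\<And>n. (\<sigma> n)\<^sup>2 = (\<Sum>i<N n. p n i * (1 - p n i))"
    and \<sigma>: "filterlim \<sigma> at_top sequentially"
  shows "(\<lambda>n. LBINT u. if 0 < \<sigma> n then cmod (indicator {- (pi * \<sigma> n)..pi * \<sigma> n} u *\<^sub>R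
           (\<Prod>i<N n. centered_bernoulli_cf (p n i) (u / \<sigma> n)) - of_real (exp (- u\<^sup>2 / 2))) else 0) \<longlonglongrightarrow> 0"
proof -
  \<comment> \<open>The guard covers the indices at which \<sigma> may vanish, so that the majorant
    is valid for every n.\<close>
  define g where "g = (\<lambda>n u. if 0 < \<sigma> n then cmod (indicator {- (pi * \<sigma> n)..pi * \<sigma> n} u *\<^sub>R
           (\<Prod>i<N n. centered_bernoulli_cf (p n i) (u / \<sigma> n)) - of_real (exp (- u\<^sup>2 / 2))) else 0)"
  have g_le: "norm (g n u) \<le> exp (- u\<^sup>2 / 16) + exp (- u\<^sup>2 / 2)" for n u
  proof (cases "0 < \<sigma> n")
    case True
    have "cmod (indicator {- (pi * \<sigma> n)..pi * \<sigma> n} u *\<^sub>R (\<Prod>i<N n. centered_bernoulli_cf (p n i) (u / \<sigma> n)))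
       \<le> exp (- u\<^sup>2 / 16)"
      using centered_bernoulli_cf_prod_tail[where N = "N n" and p = "p n" and u = u, OF p True var] by (auto split: split_indicator)
    thus ?thesis using True
      by (auto simp: g_def intro!: norm_triangle_le_diff add_mono)
  qed (auto simp: g_def)
  have meas: "g n \<in> borel_measurable lborel" for n
  proof (cases "0 < \<sigma> n")
    case True
    have [measurable]: "(\<lambda>u. \<Prod>i<N n. centered_bernoulli_cf (p n i) (u / \<sigma> n)) \<in> borel_measurable borel"
      using True by (intro borel_measurable_continuous_onI continuous_intros) auto
    show ?thesis unfolding g_def by measurable
  qed (simp add: g_def)
  have lim: "(\<lambda>n. g n u) \<longlonglongrightarrow> 0" for u
  proof -
    have "(\<lambda>n. \<bar>u\<bar> ^ 3 * inverse (\<sigma> n) + u ^ 4 * (inverse (\<sigma> n))\<^sup>2) \<longlonglongrightarrow> \<bar>u\<bar> ^ 3 * 0 + u ^ 4 * 0\<^sup>2"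
      by (intro tendsto_intros tendsto_inverse_0_at_top \<sigma>)
    hence lim0: "(\<lambda>n. \<bar>u\<bar> ^ 3 * inverse (\<sigma> n) + u ^ 4 * (inverse (\<sigma> n))\<^sup>2) \<longlonglongrightarrow> 0" by simp
    \<comment> \<open>As soon as \<sigma> exceeds |u|, the point u lies in the range of integration
      and the indicator is 1.\<close>
    have "\<forall>\<^sub>F n in sequentially. norm (g n u) \<le> \<bar>u\<bar> ^ 3 * inverse (\<sigma> n) + u ^ 4 * (inverse (\<sigma> n))\<^sup>2"
      using filterlim_at_top_dense[THEN iffD1, OF \<sigma>, rule_format, of 0]
        filterlim_at_top_dense[THEN iffD1, OF \<sigma>, rule_format, of "\<bar>u\<bar>"]
    proof eventually_elim
      case (elim n)
      have "\<sigma> n \<le> pi * \<sigma> n" using elim pi_gt3 by simp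
      hence "- (pi * \<sigma> n) \<le> u" "u \<le> pi * \<sigma> n" using elim by linarith+
      hence "u \<in> {- (pi * \<sigma> n)..pi * \<sigma> n}" by simp
      hence "indicator {- (pi * \<sigma> n)..pi * \<sigma> n} u = (1 :: real)" by (rule indicator_simps(1))
      hence "norm (g n u) = cmod ((\<Prod>i<N n. centered_bernoulli_cf (p n i) (u / \<sigma> n)) - of_real (exp (- u\<^sup>2 / 2)))"
        using elim(1) by (simp only: g_def if_True scaleR_one real_norm_def abs_norm_cancel)
      also have "\<dots> \<le> \<bar>u\<bar> ^ 3 / \<sigma> n + u ^ 4 / (\<sigma> n)\<^sup>2"
        by (rule centered_bernoulli_cf_prod_approx[OF p elim(1) var])
      finally show ?case by (simp only: divide_inverse power_inverse)
    qed
    thus ?thesis by (rule Lim_null_comparison[OF _ lim0])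
  qed
  have "(\<lambda>n. integral\<^sup>L lborel (g n)) \<longlonglongrightarrow> integral\<^sup>L lborel (\<lambda>_ :: real. 0 :: real)"
  proof (rule integral_dominated_convergence[where w = "\<lambda>u. exp (- u\<^sup>2 / 16) + exp (- u\<^sup>2 / 2)"])
    show "integrable lborel (\<lambda>u::real. exp (- u\<^sup>2 / 16) + exp (- u\<^sup>2 / 2))"
      by (intro Bochner_Integration.integrable_add integrable_exp_minus_square) auto
    show "g n \<in> borel_measurable lborel" for n by (rule meas)
    show "AE u in lborel. (\<lambda>n. g n u) \<longlonglongrightarrow> 0" by (intro AE_I2 lim)
    show "AE u in lborel. norm (g n u) \<le> exp (- u\<^sup>2 / 16) + exp (- u\<^sup>2 / 2)" for n
      by (intro AE_I2 g_le)
  qed simp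
  thus ?thesis unfolding g_def by (simp only: Bochner_Integration.integral_zero)
qed

lemma std_normal_density_le_1: "std_normal_density x \<le> 1"
proof -
  have "1 \<le> sqrt (2 * pi)" using pi_gt3 by simp
  hence "1 / sqrt (2 * pi) \<le> 1" by (simp add: field_simps)
  hence "(1 / sqrt (2 * pi)) * exp (- x\<^sup>2 / 2) \<le> 1 * 1"
    by (intro mult_mono) auto
  thus ?thesis by (simp add: std_normal_density_def)
qed

text \<open>The derivative is -z times the density, and |z| <= 1 + z^2/2 <= exp(z^2/2) bounds it by
  1. This permits the passage from lattice points to arbitrary x.\<close>

lemma std_normal_density_lipschitz: "\<bar>std_normal_density x - std_normal_density y\<bar> \<le> \<bar>x - y\<bar>"
proof -
  have "norm (std_normal_density x - std_normal_density y) \<le> 1 * norm (x - y)"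
  proof (rule field_differentiable_bound[of UNIV])
    fix z :: real
    show "(std_normal_density has_field_derivative (- z * std_normal_density z)) (at z within UNIV)"
    proof -
      define c where "c = 1 / sqrt (2 * pi)"
      show ?thesis unfolding std_normal_density_def[abs_def] c_def[symmetric]
        by (auto intro!: derivative_eq_intros)
    qed
    have s: "1 \<le> sqrt (2 * pi)" using pi_gt3 by simp
    have "0 \<le> (\<bar>z\<bar> - 1)\<^sup>2" by simp
    hence "\<bar>z\<bar> \<le> 1 + z\<^sup>2 / 2" by (simp add: power2_eq_square algebra_simps)
    also have "\<dots> \<le> exp (z\<^sup>2 / 2)" by (rule exp_ge_add_one_self)
    finally have "\<bar>z\<bar> * exp (- (z\<^sup>2 / 2)) \<le> 1" by (simp add: exp_minus field_simps)
    hence "1 / sqrt (2 * pi) * (\<bar>z\<bar> * exp (- (z\<^sup>2 / 2))) \<le> 1 * 1"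
      using s by (intro mult_mono) auto
    thus "norm (- z * std_normal_density z) \<le> 1"
      by (simp add: std_normal_density_def abs_mult)
  qed auto
  thus ?thesis by simp
qed

text \<open>At the normalised lattice point y just below x the error is at most the L1 distance
  divided by 2 pi. Moving from y to x costs at most 1/\<sigma> by the Lipschitz bound. Neither term
  depends on x.\<close>

lemma poisson_binomial_local_limit:
  fixes N :: "nat \<Rightarrow> nat" and p :: "nat \<Rightarrow> nat \<Rightarrow> real" and P :: "nat \<Rightarrow> int \<Rightarrow> real"
  assumes p: "\<And>n i. i < N n \<Longrightarrow> 0 \<le> p n i \<and> p n i \<le> 1"
    and var: "\<And>n. (\<sigma> n)\<^sup>2 = (\<Sum>i<N n. p n i * (1 - p n i))"
    and \<sigma>: "filterlim \<sigma> at_top sequentially"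
    and supp: "\<And>n k. k \<notin> {0..int n} \<Longrightarrow> P n k = 0"
    and cf: "\<And>n s. (\<Sum>j\<in>{0..int n}. of_real (P n j) * cis (s * (real_of_int j - \<mu> n))) =
       (\<Prod>i<N n. centered_bernoulli_cf (p n i) s)"
  obtains \<epsilon> where "\<epsilon> \<longlonglongrightarrow> 0" "\<forall>\<^sub>F n in sequentially. \<forall>x.
     \<bar>\<sigma> n * P n \<lfloor>\<mu> n + x * \<sigma> n\<rfloor> - std_normal_density x\<bar> \<le> \<epsilon> n"
proof -
  define D where "D = (\<lambda>n. LBINT u. if 0 < \<sigma> n then cmod (indicator {- (pi * \<sigma> n)..pi * \<sigma> n} u *\<^sub>R
           (\<Prod>i<N n. centered_bernoulli_cf (p n i) (u / \<sigma> n)) - of_real (exp (- u\<^sup>2 / 2))) else 0)"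
  define \<epsilon> where "\<epsilon> = (\<lambda>n. D n / (2 * pi) + inverse (\<sigma> n))"
  have "D \<longlonglongrightarrow> 0" unfolding D_def by (rule centered_bernoulli_cf_prod_L1_limit[OF p var \<sigma>])
  hence "\<epsilon> \<longlonglongrightarrow> 0 / (2 * pi) + 0" unfolding \<epsilon>_def
    by (intro tendsto_intros tendsto_inverse_0_at_top[OF \<sigma>]) auto
  moreover have "\<forall>\<^sub>F n in sequentially. \<forall>x.
     \<bar>\<sigma> n * P n \<lfloor>\<mu> n + x * \<sigma> n\<rfloor> - std_normal_density x\<bar> \<le> \<epsilon> n"
    using filterlim_at_top_dense[THEN iffD1, OF \<sigma>, rule_format, of 0]
  proof eventually_elim
    case (elim n)
    show ?case
    proof
      fix x
      define k where "k = \<lfloor>\<mu> n + x * \<sigma> n\<rfloor>"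
      define y where "y = (real_of_int k - \<mu> n) / \<sigma> n"
      have "2 * pi * \<bar>\<sigma> n * P n k - std_normal_density y\<bar> \<le> D n"
        using local_limit_error_bound[where P = "P n" and n = n and k = k, OF elim supp cf] elim by (simp add: D_def y_def)
      hence 1: "\<bar>\<sigma> n * P n k - std_normal_density y\<bar> \<le> D n / (2 * pi)"
        by (simp add: field_simps)
      have "real_of_int k \<le> \<mu> n + x * \<sigma> n" "\<mu> n + x * \<sigma> n < real_of_int k + 1"
        unfolding k_def by linarith+
      hence d: "0 \<le> \<mu> n + x * \<sigma> n - real_of_int k" "\<mu> n + x * \<sigma> n - real_of_int k \<le> 1"
        by linarith+
      have "x - y = (\<mu> n + x * \<sigma> n - real_of_int k) / \<sigma> n"
        using elim by (simp add: y_def field_simps)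
      hence "0 \<le> x - y" "x - y \<le> 1 / \<sigma> n"
        using elim d by (simp_all only: divide_right_mono divide_nonneg_pos less_imp_le)
      hence "\<bar>y - x\<bar> \<le> inverse (\<sigma> n)" unfolding inverse_eq_divide by linarith
      thus "\<bar>\<sigma> n * P n \<lfloor>\<mu> n + x * \<sigma> n\<rfloor> - std_normal_density x\<bar> \<le> \<epsilon> n"
        using 1 std_normal_density_lipschitz[of y x] unfolding \<epsilon>_def k_def[symmetric] by linarith
    qed
  qed
  ultimately show ?thesis by (intro that[of \<epsilon>]) auto
qed

section \<open>From the local to the central limit theorem\<close>

text \<open>The function is constant, equal to \<sigma> P k, on the cell of points t with floor k,
  which has length 1/\<sigma>; so each cell carries mass P k. The cut-off point is the right end of
  the cell of \<open>K\<close>, so that only whole cells are counted.\<close>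

lemma lattice_step_density:
  fixes P :: "int \<Rightarrow> real" and K :: int
  assumes \<sigma>: "\<sigma> > 0" and supp: "\<And>k. k \<notin> {0..int n} \<Longrightarrow> P k = 0"
  shows "has_bochner_integral lborel (\<lambda>t. \<sigma> * P \<lfloor>\<mu> + t * \<sigma>\<rfloor>) (\<Sum>k\<in>{0..int n}. P k)"
    and "has_bochner_integral lborel (\<lambda>t. indicator {..<(real_of_int K + 1 - \<mu>) / \<sigma>} t * (\<sigma> * P \<lfloor>\<mu> + t * \<sigma>\<rfloor>))
           (\<Sum>k | k \<in> {0..int n} \<and> k \<le> K. P k)"
proof -
  define I where "I = (\<lambda>k. {(real_of_int k - \<mu>) / \<sigma>..<(real_of_int k + 1 - \<mu>) / \<sigma>})"
  have I: "t \<in> I k \<longleftrightarrow> \<lfloor>\<mu> + t * \<sigma>\<rfloor> = k" for t k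
    unfolding I_def floor_eq_iff using \<sigma> by (auto simp: field_simps)
  have "(real_of_int k + 1 - \<mu>) / \<sigma> - (real_of_int k - \<mu>) / \<sigma> = 1 / \<sigma>" for k
    using \<sigma> by (simp add: field_simps)
  moreover have "(real_of_int k - \<mu>) / \<sigma> \<le> (real_of_int k + 1 - \<mu>) / \<sigma>" for k
    using \<sigma> by (simp add: divide_right_mono)
  ultimately have "measure lborel (I k) = 1 / \<sigma>" for k
    unfolding I_def by (simp only: measure_lborel_Ico)
  moreover have "emeasure lborel (I k) < \<infinity>" for k
    unfolding I_def by (cases "(real_of_int k - \<mu>) / \<sigma> \<le> (real_of_int k + 1 - \<mu>) / \<sigma>") auto
  ultimately have "has_bochner_integral lborel (indicator (I k)) (1 / \<sigma>)" for k
    using has_bochner_integral_real_indicator[of "I k" lborel] by (metis I_def atLeastLessThan_borel sets_lborel)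
  from has_bochner_integral_mult_right[OF this]
  have "has_bochner_integral lborel (\<lambda>t. \<sigma> * P k * indicator (I k) t) (\<sigma> * P k * (1 / \<sigma>))" for k
    by blast
  hence int: "has_bochner_integral lborel (\<lambda>t. \<sigma> * P k * indicator (I k) t) (P k)" for k
    using \<sigma> by simp
  have step: "\<sigma> * P \<lfloor>\<mu> + t * \<sigma>\<rfloor> = (\<Sum>k\<in>{0..int n}. \<sigma> * P k * indicator (I k) t)" for t
  proof -
    have "(\<Sum>k\<in>{0..int n}. \<sigma> * P k * indicator (I k) t) = (\<Sum>k\<in>{0..int n}. if k = \<lfloor>\<mu> + t * \<sigma>\<rfloor> then \<sigma> * P k else 0)"
      by (intro sum.cong) (auto simp: indicator_def I)
    thus ?thesis using supp[of "\<lfloor>\<mu> + t * \<sigma>\<rfloor>"] by auto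
  qed
  show "has_bochner_integral lborel (\<lambda>t. \<sigma> * P \<lfloor>\<mu> + t * \<sigma>\<rfloor>) (\<Sum>k\<in>{0..int n}. P k)"
    unfolding step by (intro has_bochner_integral_sum int)
  have "t < (real_of_int K + 1 - \<mu>) / \<sigma> \<longleftrightarrow> \<lfloor>\<mu> + t * \<sigma>\<rfloor> \<le> K" for t
    using \<sigma> unfolding floor_le_iff by (simp add: field_simps)
  hence ind: "indicator {..<(real_of_int K + 1 - \<mu>) / \<sigma>} t = (if \<lfloor>\<mu> + t * \<sigma>\<rfloor> \<le> K then 1 else 0 :: real)" for t
    by (simp only: indicator_def lessThan_iff of_bool_def)
  have cut: "indicator {..<(real_of_int K + 1 - \<mu>) / \<sigma>} t * (\<sigma> * P \<lfloor>\<mu> + t * \<sigma>\<rfloor>)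
     = (\<Sum>k | k \<in> {0..int n} \<and> k \<le> K. \<sigma> * P k * indicator (I k) t)" for t
  proof -
    have fin: "finite {k. k \<in> {0..int n} \<and> k \<le> K}" by (rule finite_subset[of _ "{0..int n}"]) auto
    have "(\<Sum>k | k \<in> {0..int n} \<and> k \<le> K. \<sigma> * P k * indicator (I k) t)
        = (\<Sum>k | k \<in> {0..int n} \<and> k \<le> K. if k = \<lfloor>\<mu> + t * \<sigma>\<rfloor> then \<sigma> * P k else 0)"
      by (intro sum.cong) (auto simp: indicator_def I)
    also have "\<dots> = indicator {..<(real_of_int K + 1 - \<mu>) / \<sigma>} t * (\<sigma> * P \<lfloor>\<mu> + t * \<sigma>\<rfloor>)"
      unfolding ind using supp[of "\<lfloor>\<mu> + t * \<sigma>\<rfloor>"] by (subst sum.delta[OF fin]) auto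
    finally show ?thesis ..
  qed
  show "has_bochner_integral lborel (\<lambda>t. indicator {..<(real_of_int K + 1 - \<mu>) / \<sigma>} t * (\<sigma> * P \<lfloor>\<mu> + t * \<sigma>\<rfloor>))
           (\<Sum>k | k \<in> {0..int n} \<and> k \<le> K. P k)"
    unfolding cut by (intro has_bochner_integral_sum int)
qed

text \<open>As f - g has integral 0, its positive and negative parts have equal integrals, and each
  bounds the difference over \<open>S\<close> in one direction. The part max 0 (g - f) is chosen
  because it is dominated by \<open>g\<close> when f >= 0 and g >= 0.\<close>

lemma scheffe_bound:
  fixes f g :: "'a \<Rightarrow> real"
  assumes f: "integrable M f" and g: "integrable M g" and eq: "integral\<^sup>L M f = integral\<^sup>L M g"
    and S: "S \<in> sets M"
  shows "\<bar>(LINT x|M. indicator S x * f x) - (LINT x|M. indicator S x * g x)\<bar> \<le> (LINT x|M. max 0 (g x - f x))"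
proof -
  have fS: "integrable M (\<lambda>x. indicator S x * f x)" and gS: "integrable M (\<lambda>x. indicator S x * g x)"
    using integrable_mult_indicator[OF S f] integrable_mult_indicator[OF S g] by auto
  have pos: "integrable M (\<lambda>x. max 0 (g x - f x))"
    using f g by (intro integrable_max) auto
  \<comment> \<open>The integrand is max 0 (f - g), written so that its integral is visibly that of
    max 0 (g - f).\<close>
  have neg: "integrable M (\<lambda>x. max 0 (g x - f x) + (f x - g x))"
    using f g pos by auto
  have "(LINT x|M. indicator S x * g x) - (LINT x|M. indicator S x * f x)
     = (LINT x|M. indicator S x * g x - indicator S x * f x)"
    using fS gS by simp
  also have "\<dots> \<le> (LINT x|M. max 0 (g x - f x))"
    using fS gS pos by (intro integral_mono) (auto split: split_indicator)
  finally have 1: "(LINT x|M. indicator S x * g x) - (LINT x|M. indicator S x * f x) \<le> (LINT x|M. max 0 (g x - f x))" .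
  have "(LINT x|M. indicator S x * f x) - (LINT x|M. indicator S x * g x)
     = (LINT x|M. indicator S x * f x - indicator S x * g x)"
    using fS gS by simp
  also have "\<dots> \<le> (LINT x|M. max 0 (g x - f x) + (f x - g x))"
    using fS gS neg by (intro integral_mono) (auto split: split_indicator)
  also have "\<dots> = (LINT x|M. max 0 (g x - f x))"
    using f g pos eq by simp
  finally show ?thesis using 1 by linarith
qed

text \<open>The density is at most 1, and a single point has measure 0. This pays for replacing a
  cell boundary y by x.\<close>

lemma normal_cdf_increment:
  assumes "x \<le> y"
  shows "\<bar>(LBINT t. indicator {..<y} t * std_normal_density t) - (LBINT t:{..x}. std_normal_density t)\<bar> \<le> y - x"
proof -
  have int: "integrable lborel (\<lambda>t. indicator A t * std_normal_density t)" if "A \<in> sets lborel" for A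
    using integrable_mult_indicator[OF that, of std_normal_density] by simp
  have ae: "AE t in lborel. t \<noteq> y" by (rule AE_lborel_singleton)
  have 1: "(LBINT t. indicator {..<y} t * std_normal_density t) = (LBINT t. indicator {..y} t * std_normal_density t)"
    by (rule integral_cong_AE) (use ae in \<open>auto split: split_indicator elim!: eventually_mono\<close>)
  have "(LBINT t. indicator {..y} t * std_normal_density t) - (LBINT t. indicator {..x} t * std_normal_density t)
      = (LBINT t. indicator {..y} t * std_normal_density t - indicator {..x} t * std_normal_density t)"
    by (intro Bochner_Integration.integral_diff[symmetric] int) auto
  also have "\<dots> = (LBINT t. indicator {x<..y} t * std_normal_density t)"
    using assms by (intro Bochner_Integration.integral_cong) (auto split: split_indicator)
  finally have 2: "(LBINT t. indicator {..y} t * std_normal_density t) - (LBINT t. indicator {..x} t * std_normal_density t)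
      = (LBINT t. indicator {x<..y} t * std_normal_density t)" .
  have "(LBINT t. indicator {x<..y} t * std_normal_density t) \<le> (LBINT t. indicator {x<..y} t)"
    using assms by (intro integral_mono int) (auto split: split_indicator simp: std_normal_density_le_1)
  also have "\<dots> = y - x" using assms by simp
  finally have 3: "(LBINT t. indicator {x<..y} t * std_normal_density t) \<le> y - x" .
  have "0 \<le> (LBINT t. indicator {x<..y} t * std_normal_density t)"
    by (intro integral_nonneg_AE) auto
  thus ?thesis using 1 2 3 by (simp add: set_lebesgue_integral_def)
qed

text \<open>The local limit is pointwise convergence of step densities, and their deficit below the
  normal density is dominated by that density. Hence its integral \<open>E n\<close> tends to 0, and
  by Scheffe's bound it controls all half-lines at once.\<close>

lemma central_limit_of_local_limit:
  fixes P :: "nat \<Rightarrow> int \<Rightarrow> real"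
  assumes nonneg: "\<And>n k. 0 \<le> P n k" and supp: "\<And>n k. k \<notin> {0..int n} \<Longrightarrow> P n k = 0"
    and sum1: "\<And>n. (\<Sum>k\<in>{0..int n}. P n k) = 1"
    and \<sigma>0: "\<And>n. 0 \<le> \<sigma> n" and \<sigma>: "filterlim \<sigma> at_top sequentially"
    and local: "\<And>x. (\<lambda>n. \<sigma> n * P n \<lfloor>\<mu> n + x * \<sigma> n\<rfloor>) \<longlonglongrightarrow> std_normal_density x"
  obtains \<epsilon> where "\<epsilon> \<longlonglongrightarrow> 0" "\<forall>\<^sub>F n in sequentially. \<forall>x.
     \<bar>(\<Sum>k | k \<in> {0..int n} \<and> real_of_int k \<le> \<mu> n + x * \<sigma> n. P n k)
       - (LBINT t:{..x}. std_normal_density t)\<bar> \<le> \<epsilon> n"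
proof -
  define g where "g = (\<lambda>n t. \<sigma> n * P n \<lfloor>\<mu> n + t * \<sigma> n\<rfloor>)"
  define E where "E = (\<lambda>n. LBINT t. max 0 (std_normal_density t - g n t))"
  have g0: "0 \<le> g n t" for n t using nonneg \<sigma>0 by (simp add: g_def)
  have "E \<longlonglongrightarrow> integral\<^sup>L lborel (\<lambda>_ :: real. 0 :: real)" unfolding E_def
  proof (rule integral_dominated_convergence[where w = std_normal_density])
    show "(\<lambda>t. max 0 (std_normal_density t - g n t)) \<in> borel_measurable lborel" for n
    proof -
      have "(\<lambda>t. \<lfloor>\<mu> n + t * \<sigma> n\<rfloor>) \<in> measurable lborel (count_space UNIV)" by measurable
      from measurable_compose[OF this, of "P n" borel]
      have "(\<lambda>t. P n \<lfloor>\<mu> n + t * \<sigma> n\<rfloor>) \<in> borel_measurable lborel" by simp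
      hence [measurable]: "g n \<in> borel_measurable lborel" unfolding g_def by (rule borel_measurable_times[OF borel_measurable_const])
      show ?thesis by measurable
    qed
    show "AE t in lborel. (\<lambda>n. max 0 (std_normal_density t - g n t)) \<longlonglongrightarrow> 0"
    proof (rule AE_I2)
      fix t
      have "(\<lambda>n. max 0 (std_normal_density t - g n t)) \<longlonglongrightarrow> max 0 (std_normal_density t - std_normal_density t)"
        unfolding g_def by (intro tendsto_intros local)
      thus "(\<lambda>n. max 0 (std_normal_density t - g n t)) \<longlonglongrightarrow> 0" by simp
    qed
    show "AE t in lborel. norm (max 0 (std_normal_density t - g n t)) \<le> std_normal_density t" for n
      using g0 by (intro AE_I2) (auto simp: max_def)
  qed auto
  hence "(\<lambda>n. E n + inverse (\<sigma> n)) \<longlonglongrightarrow> 0 + 0"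
    by (intro tendsto_add tendsto_inverse_0_at_top[OF \<sigma>]) simp
  moreover have "\<forall>\<^sub>F n in sequentially. \<forall>x.
     \<bar>(\<Sum>k | k \<in> {0..int n} \<and> real_of_int k \<le> \<mu> n + x * \<sigma> n. P n k)
       - (LBINT t:{..x}. std_normal_density t)\<bar> \<le> E n + inverse (\<sigma> n)"
    using filterlim_at_top_dense[THEN iffD1, OF \<sigma>, rule_format, of 0]
  proof eventually_elim
    case (elim n)
    show ?case
    proof
      fix x
      define K where "K = \<lfloor>\<mu> n + x * \<sigma> n\<rfloor>"
      \<comment> \<open>The right end of the cell that contains x: the sum over k <= K is the
        integral of the step density up to y, and y exceeds x by at most 1/\<sigma>.\<close>
      define y where "y = (real_of_int K + 1 - \<mu> n) / \<sigma> n"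
      have "real_of_int K \<le> \<mu> n + x * \<sigma> n" "\<mu> n + x * \<sigma> n < real_of_int K + 1"
        unfolding K_def by linarith+
      hence d: "0 \<le> real_of_int K + 1 - \<mu> n - x * \<sigma> n" "real_of_int K + 1 - \<mu> n - x * \<sigma> n \<le> 1"
        by linarith+
      have "y - x = (real_of_int K + 1 - \<mu> n - x * \<sigma> n) / \<sigma> n"
        using elim by (simp add: y_def field_simps)
      hence "0 \<le> y - x" "y - x \<le> 1 / \<sigma> n"
        using elim d by (simp_all only: divide_right_mono divide_nonneg_pos less_imp_le)
      hence y: "x \<le> y" "y - x \<le> inverse (\<sigma> n)" unfolding inverse_eq_divide by linarith+
      note step = lattice_step_density[where P = "P n" and n = n and \<mu> = "\<mu> n", OF elim supp]
      have "(\<Sum>k | k \<in> {0..int n} \<and> real_of_int k \<le> \<mu> n + x * \<sigma> n. P n k) = (\<Sum>k | k \<in> {0..int n} \<and> k \<le> K. P n k)"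
        unfolding K_def le_floor_iff ..
      also have "\<dots> = (LBINT t. indicator {..<y} t * g n t)"
        using step(2)[of K] by (simp add: has_bochner_integral_iff g_def y_def)
      finally have 1: "(\<Sum>k | k \<in> {0..int n} \<and> real_of_int k \<le> \<mu> n + x * \<sigma> n. P n k) = (LBINT t. indicator {..<y} t * g n t)" .
      have g: "integrable lborel (g n)" "integral\<^sup>L lborel (g n) = 1"
        using step(1) sum1 by (auto simp: has_bochner_integral_iff g_def)
      have "\<bar>(LBINT t. indicator {..<y} t * g n t) - (LBINT t. indicator {..<y} t * std_normal_density t)\<bar> \<le> E n"
        unfolding E_def using g by (intro scheffe_bound) auto
      thus "\<bar>(\<Sum>k | k \<in> {0..int n} \<and> real_of_int k \<le> \<mu> n + x * \<sigma> n. P n k)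
       - (LBINT t:{..x}. std_normal_density t)\<bar> \<le> E n + inverse (\<sigma> n)"
        unfolding 1 using normal_cdf_increment[OF y(1)] y(2) by linarith
    qed
  qed
  ultimately show ?thesis by (intro that) auto
qed

section \<open>Asymptotic normality\<close>

lemma prod_centered_bernoulli_cf:
  fixes N :: nat
  shows "(\<Prod>i<N. centered_bernoulli_cf (p i) s)
    = cis (- s * (\<Sum>i<N. p i)) * (\<Prod>i<N. 1 - of_real (p i) + of_real (p i) * cis s)"
proof (induction N)
  case (Suc N)
  have "cis (- s * (\<Sum>i<Suc N. p i)) = cis (- s * (\<Sum>i<N. p i)) * cis (- s * p N)"
    by (simp add: cis_mult algebra_simps)
  thus ?case using Suc by (simp add: centered_bernoulli_cf_def mult_ac)
qed simp

text \<open>By De Moivre the left side is a phase times the value of \<open>f n\<close> at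
  \<open>cis s\<close>, divided by \<open>poly (f n) 1\<close>; the factorization turns this into
  the product.\<close>

lemma nprob_centered_cf:
  assumes f: "f n = (\<Sum>k=0..n. monom (a n k) k)" and pos: "0 < poly (f n) 1"
    and fac: "\<And>w::complex. poly (map_poly of_real (f n)) w =
      of_real (poly (f n) 1) * (\<Prod>i<N. 1 - of_real (p i) + of_real (p i) * w)"
  shows "(\<Sum>j\<in>{0..int n}. of_real (nprob a n j) * cis (s * (real_of_int j - (\<Sum>i<N. p i))))
     = (\<Prod>i<(N::nat). centered_bernoulli_cf (p i) s)"
proof -
  have map: "map_poly of_real (f n) = (\<Sum>k=0..n. monom (complex_of_real (a n k)) k)"
    unfolding f by (intro poly_eqI) (simp add: coeff_map_poly coeff_sum if_distrib cong: if_cong)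
  have f1: "poly (f n) 1 = (\<Sum>k=0..n. a n k)"
    by (simp add: f poly_sum poly_monom)
  have np: "nprob a n (int k) = a n k / poly (f n) 1" if "k \<in> {0..n}" for k
    using that by (simp add: nprob_def f1)
  have "(\<Sum>j\<in>{0..int n}. of_real (nprob a n j) * cis (s * (real_of_int j - (\<Sum>i<N. p i))))
     = (\<Sum>k=0..n. of_real (nprob a n (int k)) * cis (s * (real k - (\<Sum>i<N. p i))))"
    using sum.reindex[of int "{0..n}" "\<lambda>j. of_real (nprob a n j) * cis (s * (real_of_int j - (\<Sum>i<N. p i)))"]
    by (simp add: image_int_atLeastAtMost comp_def)
  also have "\<dots> = (\<Sum>k=0..n. cis (- s * (\<Sum>i<N. p i)) / of_real (poly (f n) 1) * (of_real (a n k) * cis s ^ k))"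
  proof (rule sum.cong)
    fix k assume k: "k \<in> {0..n}"
    have "s * (real k - (\<Sum>i<N. p i)) = - s * (\<Sum>i<N. p i) + real k * s"
      by (simp add: algebra_simps)
    hence "cis (s * (real k - (\<Sum>i<N. p i))) = cis (- s * (\<Sum>i<N. p i)) * cis s ^ k"
      by (simp only: Complex.DeMoivre cis_mult)
    thus "of_real (nprob a n (int k)) * cis (s * (real k - (\<Sum>i<N. p i))) =
        cis (- s * (\<Sum>i<N. p i)) / of_real (poly (f n) 1) * (of_real (a n k) * cis s ^ k)"
      unfolding np[OF k] by simp
  qed simp
  also have "\<dots> = cis (- s * (\<Sum>i<N. p i)) / of_real (poly (f n) 1) * poly (map_poly of_real (f n)) (cis s)"
    unfolding map by (simp add: poly_sum poly_monom sum_distrib_left)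
  also have "\<dots> = (\<Prod>i<N. centered_bernoulli_cf (p i) s)"
    unfolding fac prod_centered_bernoulli_cf using pos by simp
  finally show ?thesis .
qed

lemma SUP_abs_tendsto_0:
  fixes h :: "nat \<Rightarrow> real \<Rightarrow> real"
  assumes \<epsilon>: "\<epsilon> \<longlonglongrightarrow> 0" and h: "\<forall>\<^sub>F n in sequentially. \<forall>x. \<bar>h n x\<bar> \<le> \<epsilon> n"
  shows "(\<lambda>n. SUP x. \<bar>h n x\<bar>) \<longlonglongrightarrow> 0"
proof (rule tendsto_sandwich[OF _ _ tendsto_const \<epsilon>])
  show "\<forall>\<^sub>F n in sequentially. (SUP x. \<bar>h n x\<bar>) \<le> \<epsilon> n"
    using h by eventually_elim (intro cSUP_least, auto)
  \<comment> \<open>A real supremum dominates the members of its set only if the set is bounded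
    above, so the hypothesis enters here too.\<close>
  show "\<forall>\<^sub>F n in sequentially. 0 \<le> (SUP x. \<bar>h n x\<bar>)"
    using h
  proof eventually_elim
    case (elim n)
    hence "bdd_above (range (\<lambda>x. \<bar>h n x\<bar>))" by (auto intro!: bdd_aboveI[of _ "\<epsilon> n"])
    thus ?case by (rule cSUP_upper2[where x = 0]) auto
  qed
qed

text \<open>\<open>M_large\<close> makes precise that \<open>M\<close> is large enough for an
  expansion of the variance up to o(1), and \<open>l1\<close>, \<open>l2\<close> are the limits a
  and b of condition (1).\<close>

theorem theorem2p3:
  fixes a :: "nat \<Rightarrow> nat \<Rightarrow> real" and f :: "nat \<Rightarrow> real poly"
    and \<rho> M :: nat and q r C :: "nat \<Rightarrow> real" and \<beta> :: "nat \<Rightarrow> nat \<Rightarrow> real"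
    and l1 l2 :: real and m :: int
  assumes f_def: "\<And>n. f n = (\<Sum>k=0..n. monom (a n k) k)"
    and nonneg: "\<And>n k. k \<le> n \<Longrightarrow> 0 \<le> a n k"
    and real_roots: "\<And>n z::complex. poly (map_poly of_real (f n)) z = 0 \<Longrightarrow> z \<in> \<real>"
    and pos: "\<And>n. 0 < poly (f n) 1"
    and well_defined: "well_defined_with f \<rho> M q r C \<beta>"
    and M_large: "r 3 - r 1 \<le> real M / real \<rho>" "2 * (r 2 - r 1) \<le> real M / real \<rho>"
    and lim1: "(\<lambda>n. poly (pderiv (f n)) 1 / (poly (f n) 1 * real n powr (r 2 - r 1))) \<longlonglongrightarrow> l1"
    and lim2: "(\<lambda>n. poly (pderiv (pderiv (f n))) 1 / (poly (f n) 1 * real n powr (r 3 - r 1))) \<longlonglongrightarrow> l2"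
    and m_bounds: "1 / real \<rho> \<le> real_of_int m" "real_of_int m \<le> r 3 - r 1"
    and coeff_zero: "\<And>s::int. 0 \<le> s \<Longrightarrow> s \<le> m - 1 \<Longrightarrow> power_coeff (pvar f) (real_of_int s) = 0"
    and coeff_pos: "0 < power_coeff (pvar f) (real_of_int m)"
  shows "asymp_normal_local a (pmean f) (pvar f) \<and> asymp_normal_central a (pmean f) (pvar f)"
proof -
  have "coeff (f n) k = (if k \<le> n then a n k else 0)" for n k
    unfolding f_def by (simp add: coeff_sum)
  hence nonneg_coeff: "0 \<le> coeff (f n) k" for n k
    by (cases "k \<le> n") (simp_all add: nonneg)
  have "\<forall>n. \<exists>(N::nat) p. (\<forall>i<N. 0 \<le> p i \<and> p i \<le> 1) \<and> (\<forall>w::complex. poly (map_poly of_real (f n)) w =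
      of_real (poly (f n) 1) * (\<Prod>i<N. 1 - of_real (p i) + of_real (p i) * w))"
    by (intro allI real_rooted_nonneg_factorization[OF nonneg_coeff pos real_roots])
  from choice[OF this] obtain N :: "nat \<Rightarrow> nat" where
    "\<forall>n. \<exists>p. (\<forall>i<N n. 0 \<le> p i \<and> p i \<le> 1) \<and> (\<forall>w::complex. poly (map_poly of_real (f n)) w =
      of_real (poly (f n) 1) * (\<Prod>i<N n. 1 - of_real (p i) + of_real (p i) * w))" ..
  from choice[OF this] obtain p where
    Np: "\<forall>n. (\<forall>i<N n. 0 \<le> p n i \<and> p n i \<le> 1) \<and> (\<forall>w::complex. poly (map_poly of_real (f n)) w =
      of_real (poly (f n) 1) * (\<Prod>i<N n. 1 - of_real (p n i) + of_real (p n i) * w))" ..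
  have p: "0 \<le> p n i \<and> p n i \<le> 1" if "i < N n" for n i
    using Np that by blast
  have fac: "poly (map_poly of_real (f n)) w =
      of_real (poly (f n) 1) * (\<Prod>i<N n. 1 - of_real (p n i) + of_real (p n i) * w)" for n and w :: complex
    using Np by blast
  define \<sigma> where "\<sigma> = (\<lambda>n. sqrt (pvar f n))"
  have mean: "pmean f n = (\<Sum>i<N n. p n i)" for n by (rule pmean_pvar_bernoulli_prod(1)[OF pos fac])
  have var: "pvar f n = (\<Sum>i<N n. p n i * (1 - p n i))" for n by (rule pmean_pvar_bernoulli_prod(2)[OF pos fac])
  have var0: "0 \<le> pvar f n" for n
    unfolding var using p by (intro sum_nonneg) auto
  obtain c where c: "power_expansion (pvar f) c"
    using ex_power_expansion_pvar[OF well_defined pos M_large] by blast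
  have "0 < 1 / real \<rho>" using well_defined by (simp add: well_defined_with_def)
  \<comment> \<open>So \<open>m\<close> is a positive exponent, and by uniqueness of expansions its
    coefficient in \<open>c\<close> is \<open>power_coeff (pvar f) m\<close>. A positive power thus
    occurs, which for a nonnegative sequence forces divergence to infinity.\<close>
  hence "0 < real_of_int m" using m_bounds(1) by linarith
  moreover have "c (real_of_int m) \<noteq> 0" using coeff_pos power_coeff_eq[OF c] by simp
  ultimately have "filterlim (pvar f) at_top sequentially"
    using var0 by (intro power_expansion_at_top[OF c]) auto
  hence \<sigma>: "filterlim \<sigma> at_top sequentially"
    unfolding \<sigma>_def by (rule filterlim_compose[OF sqrt_at_top])
  have supp: "nprob a n k = 0" if "k \<notin> {0..int n}" for n k
    using that by (auto simp: nprob_def)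
  have f1: "poly (f n) 1 = (\<Sum>k=0..n. a n k)" for n
    by (simp add: f_def poly_sum poly_monom)
  have prob_nonneg: "0 \<le> nprob a n k" for n k
    using nonneg by (auto simp: nprob_def intro!: divide_nonneg_nonneg sum_nonneg)
  have prob_sum: "(\<Sum>k\<in>{0..int n}. nprob a n k) = 1" for n
  proof -
    have "(\<Sum>k\<in>{0..int n}. nprob a n k) = (\<Sum>k=0..n. nprob a n (int k))"
      using sum.reindex[of int "{0..n}" "nprob a n"] by (simp add: image_int_atLeastAtMost comp_def)
    also have "\<dots> = (\<Sum>k=0..n. a n k / poly (f n) 1)"
      by (intro sum.cong) (auto simp: nprob_def f1)
    also have "\<dots> = 1" using pos[of n] unfolding f1 by (simp add: sum_divide_distrib[symmetric])
    finally show ?thesis .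
  qed
  have cf: "(\<Sum>j\<in>{0..int n}. of_real (nprob a n j) * cis (s * (real_of_int j - pmean f n)))
     = (\<Prod>i<N n. centered_bernoulli_cf (p n i) s)" for n s
    unfolding mean by (rule nprob_centered_cf[OF f_def pos fac])
  have \<sigma>2: "(\<sigma> n)\<^sup>2 = (\<Sum>i<N n. p n i * (1 - p n i))" for n
    using var0[of n] by (simp add: \<sigma>_def var)
  obtain \<epsilon> where \<epsilon>: "\<epsilon> \<longlonglongrightarrow> 0" "\<forall>\<^sub>F n in sequentially. \<forall>x.
     \<bar>\<sigma> n * nprob a n \<lfloor>pmean f n + x * \<sigma> n\<rfloor> - std_normal_density x\<bar> \<le> \<epsilon> n"
    using poisson_binomial_local_limit[where N = N and p = p and P = "nprob a" and \<sigma> = \<sigma> and \<mu> = "pmean f", OF p \<sigma>2 \<sigma> supp cf]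
    by blast
  have loc: "asymp_normal_local a (pmean f) (pvar f)"
    unfolding asymp_normal_local_def by (rule SUP_abs_tendsto_0[OF \<epsilon>[unfolded \<sigma>_def]])
  have "(\<lambda>n. \<sigma> n * nprob a n \<lfloor>pmean f n + x * \<sigma> n\<rfloor>) \<longlonglongrightarrow> std_normal_density x" for x
  proof -
    have "\<forall>\<^sub>F n in sequentially. norm (\<sigma> n * nprob a n \<lfloor>pmean f n + x * \<sigma> n\<rfloor> - std_normal_density x) \<le> \<epsilon> n"
      using \<epsilon>(2) by eventually_elim simp
    thus ?thesis by (intro LIM_zero_cancel[OF Lim_null_comparison[OF _ \<epsilon>(1)]])
  qed
  moreover have "0 \<le> \<sigma> n" for n using var0 by (simp add: \<sigma>_def)
  ultimately obtain \<delta> where \<delta>: "\<delta> \<longlonglongrightarrow> 0" "\<forall>\<^sub>F n in sequentially. \<forall>x.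
     \<bar>(\<Sum>k | k \<in> {0..int n} \<and> real_of_int k \<le> pmean f n + x * \<sigma> n. nprob a n k)
       - (LBINT t:{..x}. std_normal_density t)\<bar> \<le> \<delta> n"
    using central_limit_of_local_limit[where P = "nprob a" and \<sigma> = \<sigma> and \<mu> = "pmean f",
        OF prob_nonneg supp prob_sum _ \<sigma>]
    by blast
  have "asymp_normal_central a (pmean f) (pvar f)"
    unfolding asymp_normal_central_def by (rule SUP_abs_tendsto_0[OF \<delta>[unfolded \<sigma>_def]])
  with loc show ?thesis ..
qed

end
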